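(* Let $T$ be a rosy theory and let $\alpha$ be an ordinal. (1) Let $p(x)=\mathrm{tp}(b/A)$ be a type with $U^{\mathrm{th}}(p)=\alpha+1$. Then there are tuples $a,e$ such that $U^{\mathrm{th}}(\mathrm{tp}(b/Aa))=\alpha$, $b\downarrow^{\mathrm{th}}_A e$, $b\downarrow^{\mathrm{th}}_{Aa} e$, $\mathrm{tp}(b/Aa)$ strongly divides over $Ae$, and $U^{\mathrm{th}}(\mathrm{tp}(a/Ae))=1$. (2) If $p(x)=\mathrm{tp}(b/A)$ is a type with $U^{\mathrm{th}}(p)=\alpha+1$, then there are a non-thorn-forking extension $\mathrm{tp}(b/Ae)$ of $p$ and a tuple $a\in\mathrm{acl}(Abe)$ such that $\mathrm{tp}(a/Ae)$ is minimal.
   Context: $T$ is a complete first-order theory with $T=T^{eq}$; everything takes place in a monster model $\mathfrak C$; sets are small subsets of $\mathfrak C$; tuples are finite unless said otherwise. Thorn-forking. A formula $\varphi(x,b)$ strongly divides over $D$ if $b$ is not algebraic over $D$ and $\{\varphi(x,b') : b'\models \mathrm{tp}(b/D)\}$ is $k$-inconsistent for some $k\in\mathbb N$. It thorn-divides over $C$ if it strongly divides over some $D\supseteq C$. It thorn-forks over $C$ if it implies a finite disjunction of formulas each of which thorn-divides over $C$. A type thorn-forks over $A$ if it contains a formula that does. Write $a\downarrow^{\mathrm{th}}_A B$ if $\mathrm{tp}(a/AB)$ does not thorn-fork over $A$. $T$ is rosy if it admits no infinite thorn-forking chains, in the sense that thorn-independence has local character: for every finite tuple $a$ and set $B$ there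 is $B_0\subseteq B$ with $|B_0|\le |T|$ and $a\downarrow^{\mathrm{th}}_{B_0}B$. A type $\mathrm{tp}(b/B)$ strongly divides over a set $D$ if $B$ is not algebraic over $D$ (i.e. $B\not\subseteq\mathrm{acl}(D)$) but $B\subseteq\mathrm{acl}(Db')$ for every $b'\models\mathrm{tp}(b/B)$. So $\mathrm{tp}(b/Aa)$ strongly divides over $Ae$ means $a\notin\mathrm{acl}(Ae)$ and $a\in\mathrm{acl}(Aeb')$ for all $b'\models\mathrm{tp}(b/Aa)$. Rank. The $U^{\mathrm{th}}$-rank is the foundation rank of the thorn-forking-extension relation on types: $U^{\mathrm{th}}(p)\ge\alpha+1$ iff $p$ has a thorn-forking extension $q$ with $U^{\mathrm{th}}(q)\ge\alpha$ (with the usual clauses at $0$ and limits). A type is (thorn-)minimal if its $U^{\mathrm{th}}$-rank is $1$. *)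

theory Defs
  imports Main
begin

unbundle cardinal_syntax

section \<open>Many-sorted first-order logic\<close>

text \<open>
  Sorts are the elements of the type \<open>'s\<close>. A symbol belongs to the language iff it is assigned
  an arity (a list of argument sorts and, for functions, a result sort); constants are functions
  without arguments.
\<close>

record ('s, 'f, 'r) language =
  fun_arity :: "'f \<Rightarrow> ('s list \<times> 's) option"
  rel_arity :: "'r \<Rightarrow> 's list option"

text \<open>
  The universe of a structure is the whole type \<open>'m\<close>. Distinct sorts are disjoint, and
  \<open>sort_of\<close> tells to which sort an element belongs.
\<close>

record ('s, 'f, 'r, 'm) fo_struct = "('s, 'f, 'r) language" +
  sort_of :: "'m \<Rightarrow> 's"
  fun_int :: "'f \<Rightarrow> 'm list \<Rightarrow> 'm"
  rel_int :: "'r \<Rightarrow> 'm list \<Rightarrow> bool"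

datatype 'f trm = Var nat | App 'f "'f trm list"

text \<open>
  De Bruijn indices: \<open>Ex s \<phi>\<close> binds variable 0 of \<open>\<phi>\<close>, which ranges over the sort \<open>s\<close>.
\<close>

datatype ('s, 'f, 'r) fm =
    Bot
  | Eq "'f trm" "'f trm"
  | Rel 'r "'f trm list"
  | Neg "('s, 'f, 'r) fm"
  | Conj "('s, 'f, 'r) fm" "('s, 'f, 'r) fm"
  | Ex 's "('s, 'f, 'r) fm"

inductive trm_sort :: "('s, 'f, 'r, 'z) language_scheme \<Rightarrow> 's list \<Rightarrow> 'f trm \<Rightarrow> 's \<Rightarrow> bool"
  for L :: "('s, 'f, 'r, 'z) language_scheme" and \<Gamma> :: "'s list" where
  "n < length \<Gamma> \<Longrightarrow> trm_sort L \<Gamma> (Var n) (\<Gamma> ! n)"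
| "fun_arity L f = Some (ss, s) \<Longrightarrow> list_all2 (trm_sort L \<Gamma>) ts ss \<Longrightarrow> trm_sort L \<Gamma> (App f ts) s"

text \<open>
  \<open>is_form L \<Gamma> \<phi>\<close>: \<open>\<phi>\<close> is an \<open>L\<close>-formula (without parameters) whose free variables are among
  \<open>0, \<dots>, length \<Gamma> - 1\<close>, variable \<open>i\<close> being of sort \<open>\<Gamma> ! i\<close>.
\<close>

primrec is_form :: "('s, 'f, 'r, 'z) language_scheme \<Rightarrow> 's list \<Rightarrow> ('s, 'f, 'r) fm \<Rightarrow> bool" where
  "is_form L \<Gamma> Bot \<longleftrightarrow> True"
| "is_form L \<Gamma> (Eq t u) \<longleftrightarrow> (\<exists>s. trm_sort L \<Gamma> t s \<and> trm_sort L \<Gamma> u s)"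
| "is_form L \<Gamma> (Rel r ts) \<longleftrightarrow> (\<exists>ss. rel_arity L r = Some ss \<and> list_all2 (trm_sort L \<Gamma>) ts ss)"
| "is_form L \<Gamma> (Neg \<phi>) \<longleftrightarrow> is_form L \<Gamma> \<phi>"
| "is_form L \<Gamma> (Conj \<phi> \<psi>) \<longleftrightarrow> is_form L \<Gamma> \<phi> \<and> is_form L \<Gamma> \<psi>"
| "is_form L \<Gamma> (Ex s \<phi>) \<longleftrightarrow> is_form L (s # \<Gamma>) \<phi>"

primrec trm_val :: "('s, 'f, 'r, 'm) fo_struct \<Rightarrow> 'm list \<Rightarrow> 'f trm \<Rightarrow> 'm" where
  "trm_val M e (Var n) = e ! n"
| "trm_val M e (App f ts) = fun_int M f (map (trm_val M e) ts)"

primrec sat :: "('s, 'f, 'r, 'm) fo_struct \<Rightarrow> 'm list \<Rightarrow> ('s, 'f, 'r) fm \<Rightarrow> bool" where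
  "sat M e Bot \<longleftrightarrow> False"
| "sat M e (Eq t u) \<longleftrightarrow> trm_val M e t = trm_val M e u"
| "sat M e (Rel r ts) \<longleftrightarrow> rel_int M r (map (trm_val M e) ts)"
| "sat M e (Neg \<phi>) \<longleftrightarrow> \<not> sat M e \<phi>"
| "sat M e (Conj \<phi> \<psi>) \<longleftrightarrow> sat M e \<phi> \<and> sat M e \<psi>"
| "sat M e (Ex s \<phi>) \<longleftrightarrow> (\<exists>m. sort_of M m = s \<and> sat M (m # e) \<phi>)"

abbreviation sorts :: "('s, 'f, 'r, 'm) fo_struct \<Rightarrow> 'm list \<Rightarrow> 's list" where
  "sorts M \<equiv> map (sort_of M)"

definition is_struct :: "('s, 'f, 'r, 'm) fo_struct \<Rightarrow> bool" where
  "is_struct M \<longleftrightarrow>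
     surj (sort_of M) \<and>
     (\<forall>f ss s xs. fun_arity M f = Some (ss, s) \<and> sorts M xs = ss \<longrightarrow> sort_of M (fun_int M f xs) = s)"

text \<open>
  A complete theory is taken to be closed under consequence, so that it contains each sentence
  or its negation; \<open>|T|\<close> is then literally the cardinality of the set \<open>T\<close> (which is
  the number of formulas of the language).
\<close>

definition complete_theory :: "('s, 'f, 'r, 'z) language_scheme \<Rightarrow> ('s, 'f, 'r) fm set \<Rightarrow> bool" where
  "complete_theory L T \<longleftrightarrow>
     (\<forall>\<phi>\<in>T. is_form L [] \<phi>) \<and> (\<forall>\<phi>. is_form L [] \<phi> \<longrightarrow> \<phi> \<in> T \<or> Neg \<phi> \<in> T)"

definition models :: "('s, 'f, 'r, 'm) fo_struct \<Rightarrow> ('s, 'f, 'r) fm set \<Rightarrow> bool" where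
  "models M T \<longleftrightarrow> is_struct M \<and> (\<forall>\<phi>\<in>T. sat M [] \<phi>)"


section \<open>Formulas with parameters and types\<close>

text \<open>
  A triple \<open>(\<sigma>, \<phi>, b)\<close> stands for the formula \<open>\<phi>(x, b)\<close>: \<open>\<phi>(x, y)\<close> is a formula without
  parameters, \<open>x\<close> (the first variables) is of sorts \<open>\<sigma>\<close>, and the parameter tuple \<open>b\<close> is
  substituted for \<open>y\<close> (the remaining variables).
\<close>

type_synonym ('s, 'f, 'r, 'm) pform = "'s list \<times> ('s, 'f, 'r) fm \<times> 'm list"

definition pforms :: "('s, 'f, 'r, 'm) fo_struct \<Rightarrow> 's list \<Rightarrow> 'm set \<Rightarrow> ('s, 'f, 'r, 'm) pform set" where
  "pforms M \<sigma> A = {(\<sigma>, \<phi>, b) | \<phi> b. set b \<subseteq> A \<and> is_form M (\<sigma> @ sorts M b) \<phi>}"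

fun psols :: "('s, 'f, 'r, 'm) fo_struct \<Rightarrow> ('s, 'f, 'r, 'm) pform \<Rightarrow> 'm list set" where
  "psols M (\<sigma>, \<phi>, b) = {a. sorts M a = \<sigma> \<and> sat M (a @ b) \<phi>}"

definition tp :: "('s, 'f, 'r, 'm) fo_struct \<Rightarrow> 'm list \<Rightarrow> 'm set \<Rightarrow> ('s, 'f, 'r, 'm) pform set" where
  "tp M a A = {\<psi> \<in> pforms M (sorts M a) A. a \<in> psols M \<psi>}"

definition acl :: "('s, 'f, 'r, 'm) fo_struct \<Rightarrow> 'm set \<Rightarrow> 'm set" where
  "acl M A = {m. \<exists>\<psi> \<in> pforms M [sort_of M m] A. [m] \<in> psols M \<psi> \<and> finite (psols M \<psi>)}"


section \<open>The monster model\<close>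

definition small :: "'k rel \<Rightarrow> 'm set \<Rightarrow> bool" where
  "small \<kappa> A \<longleftrightarrow> |A| <o \<kappa>"

definition saturated :: "('s, 'f, 'r, 'm) fo_struct \<Rightarrow> 'k rel \<Rightarrow> bool" where
  "saturated M \<kappa> \<longleftrightarrow>
     (\<forall>A \<sigma> \<Phi>. small \<kappa> A \<and> \<Phi> \<subseteq> pforms M \<sigma> A \<and>
        (\<forall>\<Phi>\<^sub>0 \<subseteq> \<Phi>. finite \<Phi>\<^sub>0 \<longrightarrow> (\<exists>a. sorts M a = \<sigma> \<and> (\<forall>\<psi>\<in>\<Phi>\<^sub>0. a \<in> psols M \<psi>))) \<longrightarrow>
        (\<exists>a. sorts M a = \<sigma> \<and> (\<forall>\<psi>\<in>\<Phi>. a \<in> psols M \<psi>)))"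

definition automorphism :: "('s, 'f, 'r, 'm) fo_struct \<Rightarrow> ('m \<Rightarrow> 'm) \<Rightarrow> bool" where
  "automorphism M h \<longleftrightarrow>
     bij h \<and> (\<forall>m. sort_of M (h m) = sort_of M m) \<and>
     (\<forall>f ss s xs. fun_arity M f = Some (ss, s) \<and> sorts M xs = ss \<longrightarrow>
        h (fun_int M f xs) = fun_int M f (map h xs)) \<and>
     (\<forall>r ss xs. rel_arity M r = Some ss \<and> sorts M xs = ss \<longrightarrow>
        (rel_int M r (map h xs) \<longleftrightarrow> rel_int M r xs))"

definition partial_elementary :: "('s, 'f, 'r, 'm) fo_struct \<Rightarrow> 'm set \<Rightarrow> ('m \<Rightarrow> 'm) \<Rightarrow> bool" where
  "partial_elementary M A g \<longleftrightarrow> (\<forall>c. set c \<subseteq> A \<longrightarrow> tp M (map g c) {} = tp M c {})"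

definition strongly_homogeneous :: "('s, 'f, 'r, 'm) fo_struct \<Rightarrow> 'k rel \<Rightarrow> bool" where
  "strongly_homogeneous M \<kappa> \<longleftrightarrow>
     (\<forall>A g. small \<kappa> A \<and> partial_elementary M A g \<longrightarrow>
        (\<exists>h. automorphism M h \<and> (\<forall>m\<in>A. h m = g m)))"

text \<open>
  Smallness means cardinality less than \<open>\<kappa>\<close>. ``Sufficiently large'' is made precise as
  \<open>2\<^bsup>|T|\<^esup> < \<kappa>\<close>. In particular sets of cardinality \<open>|T|\<^sup>+\<close> are small, without which the
  definition of rosiness below would say nothing.
\<close>

definition monster_model ::
  "('s, 'f, 'r) fm set \<Rightarrow> ('s, 'f, 'r, 'm) fo_struct \<Rightarrow> 'k rel \<Rightarrow> bool" where
  "monster_model T M \<kappa> \<longleftrightarrow>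
     complete_theory M T \<and> models M T \<and> Card_order \<kappa> \<and> |Pow T| <o \<kappa> \<and>
     saturated M \<kappa> \<and> strongly_homogeneous M \<kappa>"

text \<open>
  \<open>T = T\<^sup>e\<^sup>q\<close>: for every 0-definable equivalence relation \<open>E\<close> on a finite product of sorts, the
  quotient by \<open>E\<close> is already a sort, i.e. some 0-definable map \<open>f\<close> (with graph \<open>G\<close>) from that
  product onto a sort \<open>t\<close> has the \<open>E\<close>-classes as fibres. As \<open>T\<close> is complete, it suffices to say
  this in one model.
\<close>

definition eq_closed :: "('s, 'f, 'r, 'm) fo_struct \<Rightarrow> bool" where
  "eq_closed M \<longleftrightarrow>
     (\<forall>\<sigma> E. is_form M (\<sigma> @ \<sigma>) E \<and>
        equiv {u. sorts M u = \<sigma>} {(u, v). sorts M u = \<sigma> \<and> sorts M v = \<sigma> \<and> sat M (u @ v) E} \<longrightarrow>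
        (\<exists>t G f. is_form M (\<sigma> @ [t]) G \<and>
           f ` {u. sorts M u = \<sigma>} = {z. sort_of M z = t} \<and>
           (\<forall>u z. sorts M u = \<sigma> \<and> sort_of M z = t \<longrightarrow> (sat M (u @ [z]) G \<longleftrightarrow> f u = z)) \<and>
           (\<forall>u v. sorts M u = \<sigma> \<and> sorts M v = \<sigma> \<longrightarrow> (f u = f v \<longleftrightarrow> sat M (u @ v) E))))"


section \<open>Thorn-forking\<close>

text \<open>
  \<open>k\<close>-inconsistency of \<open>{\<phi>(x, b') : b' \<Turnstile> tp(b/D)}\<close> means that any \<open>k\<close> pairwise distinct
  realisations \<open>b'\<close> give jointly inconsistent formulas \<open>\<phi>(x, b')\<close>. Counting the tuples \<open>b'\<close>
  rather than the solution sets excludes dividing by means of dummy parameters.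
\<close>

fun strongly_divides :: "('s, 'f, 'r, 'm) fo_struct \<Rightarrow> ('s, 'f, 'r, 'm) pform \<Rightarrow> 'm set \<Rightarrow> bool" where
  "strongly_divides M (\<sigma>, \<phi>, b) D \<longleftrightarrow>
     \<not> set b \<subseteq> acl M D \<and>
     (\<exists>k. \<forall>S. S \<subseteq> {b'. tp M b' D = tp M b D} \<and> finite S \<and> card S = k \<longrightarrow>
        \<not> (\<exists>a. sorts M a = \<sigma> \<and> (\<forall>b'\<in>S. a \<in> psols M (\<sigma>, \<phi>, b'))))"

definition thorn_divides ::
  "('s, 'f, 'r, 'm) fo_struct \<Rightarrow> 'k rel \<Rightarrow> ('s, 'f, 'r, 'm) pform \<Rightarrow> 'm set \<Rightarrow> bool" where
  "thorn_divides M \<kappa> \<psi> C \<longleftrightarrow> (\<exists>D. C \<subseteq> D \<and> small \<kappa> D \<and> strongly_divides M \<psi> D)"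

definition thorn_forks ::
  "('s, 'f, 'r, 'm) fo_struct \<Rightarrow> 'k rel \<Rightarrow> ('s, 'f, 'r, 'm) pform \<Rightarrow> 'm set \<Rightarrow> bool" where
  "thorn_forks M \<kappa> \<psi> C \<longleftrightarrow>
     (\<exists>F. finite F \<and> F \<subseteq> pforms M (fst \<psi>) UNIV \<and> (\<forall>\<theta>\<in>F. thorn_divides M \<kappa> \<theta> C) \<and>
        psols M \<psi> \<subseteq> (\<Union>\<theta>\<in>F. psols M \<theta>))"

definition type_thorn_forks ::
  "('s, 'f, 'r, 'm) fo_struct \<Rightarrow> 'k rel \<Rightarrow> ('s, 'f, 'r, 'm) pform set \<Rightarrow> 'm set \<Rightarrow> bool" where
  "type_thorn_forks M \<kappa> p A \<longleftrightarrow> (\<exists>\<psi>\<in>p. thorn_forks M \<kappa> \<psi> A)"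

text \<open>\<open>thorn_indep M \<kappa> a A B\<close>: the tuple \<open>a\<close> is thorn-independent from \<open>B\<close> over \<open>A\<close>.\<close>

definition thorn_indep ::
  "('s, 'f, 'r, 'm) fo_struct \<Rightarrow> 'k rel \<Rightarrow> 'm list \<Rightarrow> 'm set \<Rightarrow> 'm set \<Rightarrow> bool" where
  "thorn_indep M \<kappa> a A B \<longleftrightarrow> \<not> type_thorn_forks M \<kappa> (tp M a (A \<union> B)) A"

definition rosy ::
  "('s, 'f, 'r) fm set \<Rightarrow> ('s, 'f, 'r, 'm) fo_struct \<Rightarrow> 'k rel \<Rightarrow> bool" where
  "rosy T M \<kappa> \<longleftrightarrow>
     (\<forall>a B. small \<kappa> B \<longrightarrow> (\<exists>B\<^sub>0 \<subseteq> B. |B\<^sub>0| \<le>o |T| \<and> thorn_indep M \<kappa> a B\<^sub>0 B))"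

text \<open>\<open>type_strongly_divides M b B D\<close>: the type \<open>tp(b/B)\<close> strongly divides over the set \<open>D\<close>.\<close>

definition type_strongly_divides ::
  "('s, 'f, 'r, 'm) fo_struct \<Rightarrow> 'm list \<Rightarrow> 'm set \<Rightarrow> 'm set \<Rightarrow> bool" where
  "type_strongly_divides M b B D \<longleftrightarrow>
     \<not> B \<subseteq> acl M D \<and> (\<forall>b'. tp M b' B = tp M b B \<longrightarrow> B \<subseteq> acl M (D \<union> set b'))"


section \<open>The thorn U-rank\<close>

text \<open>
  Every type over a small set is realised in the monster model, and \<open>tp(b/B)\<close> extends \<open>p\<close>, a type
  over \<open>A \<subseteq> B\<close>, iff \<open>p = tp(b/A)\<close>. The set \<open>A\<close> is determined by \<open>p\<close>, being the set of all
  parameters that occur in it.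
\<close>

definition thorn_forking_extension ::
  "('s, 'f, 'r, 'm) fo_struct \<Rightarrow> 'k rel \<Rightarrow> ('s, 'f, 'r, 'm) pform set \<Rightarrow> ('s, 'f, 'r, 'm) pform set \<Rightarrow> bool"
where
  "thorn_forking_extension M \<kappa> p q \<longleftrightarrow>
     (\<exists>b A B. A \<subseteq> B \<and> small \<kappa> B \<and> p = tp M b A \<and> q = tp M b B \<and> type_thorn_forks M \<kappa> q A)"

text \<open>
  Ordinals are represented by the elements of an arbitrary well-ordered type \<open>'o\<close>, the element
  \<open>\<alpha>\<close> standing for the order type of \<open>{\<beta>. \<beta> < \<alpha>}\<close>.
\<close>

definition ord_zero :: "'o::wellorder \<Rightarrow> bool" where
  "ord_zero \<alpha> \<longleftrightarrow> \<not> (\<exists>\<beta>. \<beta> < \<alpha>)"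

definition ord_succ :: "'o::wellorder \<Rightarrow> 'o \<Rightarrow> bool" where
  "ord_succ \<alpha> \<alpha>' \<longleftrightarrow> \<alpha> < \<alpha>' \<and> (\<forall>\<gamma>. \<alpha> < \<gamma> \<longrightarrow> \<alpha>' \<le> \<gamma>)"

definition ord_limit :: "'o::wellorder \<Rightarrow> bool" where
  "ord_limit \<alpha> \<longleftrightarrow> \<not> ord_zero \<alpha> \<and> \<not> (\<exists>\<beta>. ord_succ \<beta> \<alpha>)"

inductive Uth_ge ::
  "('s, 'f, 'r, 'm) fo_struct \<Rightarrow> 'k rel \<Rightarrow> ('s, 'f, 'r, 'm) pform set \<Rightarrow> 'o::wellorder \<Rightarrow> bool"
  for M :: "('s, 'f, 'r, 'm) fo_struct" and \<kappa> :: "'k rel" where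
  zero: "ord_zero \<alpha> \<Longrightarrow> Uth_ge M \<kappa> p \<alpha>"
| succ: "ord_succ \<alpha> \<alpha>' \<Longrightarrow> thorn_forking_extension M \<kappa> p q \<Longrightarrow> Uth_ge M \<kappa> q \<alpha> \<Longrightarrow> Uth_ge M \<kappa> p \<alpha>'"
| limit: "ord_limit \<alpha> \<Longrightarrow> (\<And>\<beta>. \<beta> < \<alpha> \<Longrightarrow> Uth_ge M \<kappa> p \<beta>) \<Longrightarrow> Uth_ge M \<kappa> p \<alpha>"

text \<open>
  \<open>U(p) = \<alpha>\<close> means \<open>U(p) \<ge> \<alpha>\<close> and not \<open>U(p) \<ge> \<alpha> + 1\<close>; the latter is spelled out because \<open>\<alpha>\<close> may
  be the greatest element of \<open>'o\<close>.
\<close>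

definition Uth_eq ::
  "('s, 'f, 'r, 'm) fo_struct \<Rightarrow> 'k rel \<Rightarrow> ('s, 'f, 'r, 'm) pform set \<Rightarrow> 'o::wellorder \<Rightarrow> bool" where
  "Uth_eq M \<kappa> p \<alpha> \<longleftrightarrow>
     Uth_ge M \<kappa> p \<alpha> \<and> \<not> (\<exists>q. thorn_forking_extension M \<kappa> p q \<and> Uth_ge M \<kappa> q \<alpha>)"

definition thorn_minimal ::
  "('s, 'f, 'r, 'm) fo_struct \<Rightarrow> 'k rel \<Rightarrow> ('s, 'f, 'r, 'm) pform set \<Rightarrow> bool" where
  "thorn_minimal M \<kappa> p \<longleftrightarrow> Uth_eq M \<kappa> p (1::nat)"

end

theory Submission
  imports Defs
begin

text \<open>
  Write \<open>U(b/C)\<close> for the rank of \<open>tp(b/C)\<close>. The proof rests on a description of the successor step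
  of the rank by algebraic closure alone: \<open>U(b/C) \<ge> \<beta> + 1\<close> iff there are an element \<open>m\<close> and a finite
  tuple \<open>d\<close> such that
    \<open>m \<notin> acl(Cd)\<close>, \<open>m \<in> acl(Cdb)\<close> and \<open>U(b/Cdm) \<ge> \<beta>\<close>.

  One half of this is that \<open>m \<in> acl(Db)\<close> and \<open>m \<notin> acl(D)\<close> make \<open>tp(b/Dm)\<close> contain a formula that
  strongly divides over \<open>D\<close>, namely ``\<open>m\<close> lies in the finite set defined from \<open>x\<close>'' with a bound on
  the size of that set (\<open>type_thorn_forksI\<close>). Conversely, if \<open>b\<close> satisfies a formula \<open>\<phi>(x,c)\<close> that
  strongly divides over \<open>D\<close>, then fewer than \<open>k\<close> conjugates of \<open>c\<close> over \<open>D\<close> satisfy \<open>\<phi>(b,y)\<close>, whence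
  \<open>c \<in> acl(Db)\<close> but \<open>c \<notin> acl(D)\<close> (\<open>strongly_divides_acl\<close>). However, a thorn-forking extension
  \<open>tp(b/B)\<close> of rank \<open>\<ge> \<beta>\<close> only implies a disjunction of such formulas, whose parameters may lie
  outside \<open>B\<close>. So these parameters have to be adjoined to \<open>B\<close> without a loss of rank.

  This is what \<open>Uth_ge_thorn_indep\<close> achieves: if a finite tuple \<open>f\<close> is thorn-independent from \<open>b\<close>
  over \<open>C\<close>, then \<open>U(b/C) \<ge> \<alpha>\<close> implies \<open>U(b/Cf) \<ge> \<alpha>\<close>. It is shown by induction on \<open>\<alpha>\<close>, together
  with the description above. Given \<open>m\<close> and \<open>d\<close> for \<open>b\<close> over \<open>C\<close>, move \<open>f\<close> over \<open>Cb\<close> so that it becomes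
  thorn-independent from \<open>bdm\<close> over \<open>C\<close>. Then \<open>m \<notin> acl(Cdf)\<close>, as otherwise \<open>tp(f/Cdm)\<close> would
  thorn-fork over \<open>C\<close>, so \<open>m\<close> and \<open>d\<close> also witness the step over \<open>Cf\<close>. Independent tuples exist
  because local character yields that \<open>tp(f/C)\<close> does not thorn-fork over \<open>C\<close>, and because
  saturation extends a non-thorn-forking type to any small set of parameters.

  Now let \<open>U(b/A) = \<alpha> + 1\<close>, take \<open>m\<close> and \<open>d\<close> as above for \<open>\<beta> = \<alpha>\<close>, and put \<open>a = md\<close> and \<open>e = d\<close>. The
  type \<open>tp(b/Aa)\<close> strongly divides over \<open>Ae\<close>, as \<open>m \<in> acl(Adb')\<close> for all conjugates \<open>b'\<close> of \<open>b\<close> over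
  \<open>Amd\<close>. That \<open>b\<close> is thorn-independent from \<open>e\<close> over \<open>Aa\<close> is the existence property, as \<open>e\<close> is part
  of \<open>a\<close>. The remaining assertions hold because otherwise \<open>U(b/A) \<ge> \<alpha> + 2\<close>. Indeed \<open>tp(b/Aa)\<close>
  thorn-forks over \<open>A\<close>, so \<open>U(b/Aa) \<ge> \<alpha> + 1\<close> is impossible; and \<open>U(b/Ad) \<ge> \<alpha> + 1\<close>, so \<open>tp(b/Ad)\<close>
  cannot thorn-fork over \<open>A\<close>. The same contradiction arises if \<open>U(a/Ae) \<ge> 2\<close>. In that case there are
  \<open>n\<close> and \<open>f\<close> with \<open>n \<in> acl(Adfm)\<close>, \<open>n \<notin> acl(Adf)\<close> and \<open>m \<notin> acl(Adfn)\<close>, and \<open>fn\<close> may be assumed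
  thorn-independent from \<open>b\<close> over \<open>Adm\<close>. Then
  \<open>U(b/Adfnm) \<ge> \<alpha>\<close>, so \<open>U(b/Adfn) \<ge> \<alpha> + 1\<close> because of \<open>m\<close>, and \<open>tp(b/Adfn)\<close> thorn-forks over \<open>A\<close>
  because of \<open>n\<close>. The second part of the theorem follows from the first, since strong dividing
  puts \<open>a\<close> into \<open>acl(Aeb)\<close>.
\<close>

section \<open>Renaming of variables and definable relations\<close>

primrec ren_trm :: "(nat \<Rightarrow> nat) \<Rightarrow> 'f trm \<Rightarrow> 'f trm" where
  "ren_trm r (Var n) = Var (r n)"
| "ren_trm r (App f ts) = App f (map (ren_trm r) ts)"

definition lift_ren :: "(nat \<Rightarrow> nat) \<Rightarrow> nat \<Rightarrow> nat" where
  "lift_ren r n = (case n of 0 \<Rightarrow> 0 | Suc k \<Rightarrow> Suc (r k))"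

primrec ren :: "(nat \<Rightarrow> nat) \<Rightarrow> ('s, 'f, 'r) fm \<Rightarrow> ('s, 'f, 'r) fm" where
  "ren r Bot = Bot"
| "ren r (Eq t u) = Eq (ren_trm r t) (ren_trm r u)"
| "ren r (Rel R ts) = Rel R (map (ren_trm r) ts)"
| "ren r (Neg \<phi>) = Neg (ren r \<phi>)"
| "ren r (Conj \<phi> \<psi>) = Conj (ren r \<phi>) (ren r \<psi>)"
| "ren r (Ex s \<phi>) = Ex s (ren (lift_ren r) \<phi>)"

definition ren_ok :: "(nat \<Rightarrow> nat) \<Rightarrow> 's list \<Rightarrow> 's list \<Rightarrow> bool" where
  "ren_ok r \<Gamma> \<Delta> \<longleftrightarrow> (\<forall>n < length \<Gamma>. r n < length \<Delta> \<and> \<Delta> ! r n = \<Gamma> ! n)"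

abbreviation pull :: "(nat \<Rightarrow> nat) \<Rightarrow> nat \<Rightarrow> 'm list \<Rightarrow> 'm list" where
  "pull r n e \<equiv> map (\<lambda>i. e ! r i) [0..<n]"

lemma ren_ok_lift: "ren_ok r \<Gamma> \<Delta> \<Longrightarrow> ren_ok (lift_ren r) (s # \<Gamma>) (s # \<Delta>)"
  by (auto simp: ren_ok_def lift_ren_def nth_Cons split: nat.splits)

lemma pull_lift: "pull (lift_ren r) (Suc n) (m # e) = m # pull r n e"
  by (simp add: map_upt_Suc lift_ren_def del: upt_Suc)

lemma sorts_pull: "ren_ok r \<Gamma> (sorts M e) \<Longrightarrow> sorts M (pull r (length \<Gamma>) e) = \<Gamma>"
  by (auto simp: ren_ok_def intro!: nth_equalityI)

lemma trm_sort_ren: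
  assumes "trm_sort L \<Gamma> t s" "ren_ok r \<Gamma> \<Delta>"
  shows "trm_sort L \<Delta> (ren_trm r t) s"
  using assms
proof (induction rule: trm_sort.induct)
  case (1 n)
  then show ?case using trm_sort.intros(1)[of "r n" \<Delta> L] by (auto simp: ren_ok_def)
next
  case (2 f ss s ts)
  have "list_all2 (trm_sort L \<Delta>) (map (ren_trm r) ts) ss"
    using 2(2,3) by (auto simp: list_all2_map1 elim: list_all2_mono)
  then show ?case using 2(1) by (auto intro: trm_sort.intros)
qed

lemma trm_val_ren:
  assumes "trm_sort L \<Gamma> t s"
  shows "trm_val M e (ren_trm r t) = trm_val M (pull r (length \<Gamma>) e) t"
  using assms
proof (induction rule: trm_sort.induct)
  case (2 f ss s ts)
  have "map (trm_val M e \<circ> ren_trm r) ts = map (trm_val M (pull r (length \<Gamma>) e)) ts"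
    using 2(2) by (auto simp: list_all2_conv_all_nth in_set_conv_nth)
  then show ?case by (simp only: trm_val.simps ren_trm.simps map_map)
qed simp

lemma is_form_ren: "is_form L \<Gamma> \<phi> \<Longrightarrow> ren_ok r \<Gamma> \<Delta> \<Longrightarrow> is_form L \<Delta> (ren r \<phi>)"
proof (induction \<phi> arbitrary: \<Gamma> \<Delta> r)
  case (Rel R ts)
  then show ?case
    by (auto simp: list_all2_map1 elim!: list_all2_mono intro: trm_sort_ren)
qed (auto intro: trm_sort_ren ren_ok_lift)

lemma sat_ren: "is_form L \<Gamma> \<phi> \<Longrightarrow> sat M e (ren r \<phi>) \<longleftrightarrow> sat M (pull r (length \<Gamma>) e) \<phi>"
proof (induction \<phi> arbitrary: \<Gamma> r e)
  case (Eq t u)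
  then show ?case by (auto simp: trm_val_ren)
next
  case (Rel R ts)
  then obtain ss where ss: "list_all2 (trm_sort L \<Gamma>) ts ss" by auto
  have "\<exists>s. trm_sort L \<Gamma> t s" if "t \<in> set ts" for t
    using ss that by (metis in_set_conv_nth list_all2_conv_all_nth)
  then have "map (trm_val M e \<circ> ren_trm r) ts = map (trm_val M (pull r (length \<Gamma>) e)) ts"
    using trm_val_ren by fastforce
  then show ?case by (simp only: sat.simps ren.simps map_map)
next
  case (Ex s \<phi>)
  then have "sat M (m # e) (ren (lift_ren r) \<phi>) \<longleftrightarrow> sat M (m # pull r (length \<Gamma>) e) \<phi>" for m
    using Ex(1)[of "s # \<Gamma>" "m # e" "lift_ren r"] by (simp only: length_Cons pull_lift is_form.simps)
  then show ?case by simp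
next
  case (Conj \<phi> \<psi>)
  have "is_form L \<Gamma> \<phi>" "is_form L \<Gamma> \<psi>" using Conj.prems by auto
  then show ?case by (simp only: sat.simps ren.simps Conj.IH)
qed simp_all

text \<open>
  Formulas with de Bruijn indices are awkward to write down. From here on they are only handled
  through the relations that they define on environments of given sorts, and the closure properties
  of these relations replace the construction of concrete formulas.
\<close>

definition definable :: "('s, 'f, 'r, 'm) fo_struct \<Rightarrow> 's list \<Rightarrow> ('m list \<Rightarrow> bool) \<Rightarrow> bool" where
  "definable M \<sigma> R \<longleftrightarrow> (\<exists>\<phi>. is_form M \<sigma> \<phi> \<and> (\<forall>e. sorts M e = \<sigma> \<longrightarrow> (sat M e \<phi> \<longleftrightarrow> R e)))"

lemma definable_cong:
  "definable M \<sigma> R \<Longrightarrow> (\<And>e. sorts M e = \<sigma> \<Longrightarrow> R e = R' e) \<Longrightarrow> definable M \<sigma> R'"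
  by (auto simp: definable_def)

lemma definable_sat: "is_form M \<sigma> \<phi> \<Longrightarrow> definable M \<sigma> (\<lambda>e. sat M e \<phi>)"
  by (auto simp: definable_def)

lemma definable_True: "definable M \<sigma> (\<lambda>e. True)"
  by (auto simp: definable_def intro!: exI[of _ "Neg Bot"])

lemma definable_not: "definable M \<sigma> R \<Longrightarrow> definable M \<sigma> (\<lambda>e. \<not> R e)"
  unfolding definable_def by (metis is_form.simps(4) sat.simps(4))

lemma definable_conj: "definable M \<sigma> R \<Longrightarrow> definable M \<sigma> R' \<Longrightarrow> definable M \<sigma> (\<lambda>e. R e \<and> R' e)"
  unfolding definable_def by (metis is_form.simps(5) sat.simps(5))

lemma definable_ex:
  assumes "definable M (s # \<sigma>) R"
  shows "definable M \<sigma> (\<lambda>e. \<exists>m. sort_of M m = s \<and> R (m # e))"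
proof -
  obtain \<phi> where "is_form M (s # \<sigma>) \<phi>" "\<forall>e. sorts M e = s # \<sigma> \<longrightarrow> (sat M e \<phi> \<longleftrightarrow> R e)"
    using assms by (auto simp: definable_def)
  then have "is_form M \<sigma> (Ex s \<phi>)"
    "\<forall>e. sorts M e = \<sigma> \<longrightarrow> (sat M e (Ex s \<phi>) \<longleftrightarrow> (\<exists>m. sort_of M m = s \<and> R (m # e)))"
    by (auto simp: Cons_eq_map_conv)
  then show ?thesis unfolding definable_def by blast
qed

lemma definable_eq:
  "i < length \<sigma> \<Longrightarrow> j < length \<sigma> \<Longrightarrow> \<sigma> ! i = \<sigma> ! j \<Longrightarrow> definable M \<sigma> (\<lambda>e. e ! i = e ! j)"
  unfolding definable_def
  by (rule exI[of _ "Eq (Var i) (Var j)"])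
    (use trm_sort.intros(1)[of i \<sigma> M] trm_sort.intros(1)[of j \<sigma> M] in auto)

lemma definable_ball:
  "finite I \<Longrightarrow> (\<And>i. i \<in> I \<Longrightarrow> definable M \<sigma> (R i)) \<Longrightarrow> definable M \<sigma> (\<lambda>e. \<forall>i\<in>I. R i e)"
  by (induction I rule: finite_induct) (auto intro: definable_True definable_conj)

lemma definable_pull:
  assumes "definable M \<sigma> R" "ren_ok r \<sigma> \<tau>"
  shows "definable M \<tau> (\<lambda>e. R (pull r (length \<sigma>) e))"
proof -
  obtain \<phi> where \<phi>: "is_form M \<sigma> \<phi>" "\<forall>e. sorts M e = \<sigma> \<longrightarrow> (sat M e \<phi> \<longleftrightarrow> R e)"
    using assms(1) by (auto simp: definable_def)
  have "sat M e (ren r \<phi>) \<longleftrightarrow> R (pull r (length \<sigma>) e)" if "sorts M e = \<tau>" for e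
    using \<phi> assms(2) that sorts_pull[of r \<sigma> M e] by (simp add: sat_ren)
  then show ?thesis
    unfolding definable_def using is_form_ren[OF \<phi>(1) assms(2)] by blast
qed

text \<open>
  Adding dummy variables in the middle of a context, as happens when parameters of another formula
  are inserted.
\<close>

lemma definable_skip:
  assumes "definable M (\<sigma> @ \<tau>) R"
  shows "definable M (\<sigma> @ \<rho> @ \<tau>) (\<lambda>e. R (take (length \<sigma>) e @ drop (length \<sigma> + length \<rho>) e))"
proof -
  define r where "r i = (if i < length \<sigma> then i else i + length \<rho>)" for i
  have ok: "ren_ok r (\<sigma> @ \<tau>) (\<sigma> @ \<rho> @ \<tau>)"
    by (auto simp: ren_ok_def r_def nth_append)
  have "pull r (length (\<sigma> @ \<tau>)) e = take (length \<sigma>) e @ drop (length \<sigma> + length \<rho>) e"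
    if "sorts M e = \<sigma> @ \<rho> @ \<tau>" for e
  proof -
    have "length e = length \<sigma> + length \<rho> + length \<tau>"
      using arg_cong[OF that, of length] by simp
    then show ?thesis
      by (intro nth_equalityI) (auto simp: r_def nth_append add.commute add.left_commute)
  qed
  then show ?thesis
    by (intro definable_cong[OF definable_pull[OF assms ok]]) simp
qed

text \<open>
  The form in which permutations and identifications of variables occur below: a tuple \<open>c\<close> whose
  entries are picked from a tuple \<open>e0\<close> by \<open>r\<close> tells how the sorts of the two contexts correspond.
\<close>

lemma definable_rearrange:
  assumes "definable M \<sigma> R" "\<And>i. i < length c \<Longrightarrow> c ! i = e0 ! r i"
    and "sorts M c = \<sigma>" "\<And>i. i < length c \<Longrightarrow> r i < length e0"
  shows "definable M (sorts M e0) (\<lambda>e. R (pull r (length \<sigma>) e))"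
  by (rule definable_pull) (use assms in \<open>auto simp: ren_ok_def\<close>)

text \<open>
  The quantifier ``there are at least \<open>n\<close> elements \<open>y\<close> with \<open>R\<close>''. The induction on \<open>n\<close> chooses the
  elements one by one, and keeps those that have been chosen already as the first \<open>j\<close> variables.
\<close>

lemma definable_many:
  assumes "definable M (s # \<sigma>) R"
  shows "definable M \<sigma> (\<lambda>e. \<exists>ys. distinct ys \<and> length ys = n \<and>
           (\<forall>y\<in>set ys. sort_of M y = s \<and> R (y # e)))"
proof -
  have "definable M (replicate j s @ \<sigma>) (\<lambda>e. \<exists>ys. distinct ys \<and> length ys = n \<and>
           set ys \<inter> set (take j e) = {} \<and>
           (\<forall>y\<in>set ys. sort_of M y = s \<and> R (y # drop j e)))" for j
  proof (induction n arbitrary: j)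
    case 0
    then show ?case by (auto intro: definable_True)
  next
    case (Suc n)
    let ?P = "\<lambda>n j e. \<exists>ys. distinct ys \<and> length ys = n \<and> set ys \<inter> set (take j e) = {} \<and>
           (\<forall>y\<in>set ys. sort_of M y = s \<and> R (y # drop j e))"
    let ?\<Gamma> = "s # replicate j s @ \<sigma>"
    have 1: "definable M ?\<Gamma> (\<lambda>e. R (take 1 e @ drop (1 + j) e))"
      using definable_skip[of M "[s]" \<sigma> R "replicate j s"] assms by simp
    have 2: "definable M ?\<Gamma> (\<lambda>e. \<forall>i\<in>{..<j}. \<not> e ! 0 = e ! Suc i)"
      by (intro definable_ball definable_not definable_eq) (auto simp: nth_append)
    have 3: "definable M ?\<Gamma> (?P n (Suc j))"
      using Suc[of "Suc j"] by simp
    have "definable M (replicate j s @ \<sigma>) (\<lambda>e. \<exists>y. sort_of M y = s \<and>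
       (R (take 1 (y # e) @ drop (1 + j) (y # e)) \<and>
        (\<forall>i\<in>{..<j}. \<not> (y # e) ! 0 = (y # e) ! Suc i) \<and> ?P n (Suc j) (y # e)))"
      by (intro definable_ex[where R="\<lambda>e. R (take 1 e @ drop (1 + j) e) \<and>
        (\<forall>i\<in>{..<j}. \<not> e ! 0 = e ! Suc i) \<and> ?P n (Suc j) e"] definable_conj 1 2 3)
    then show ?case
    proof (rule definable_cong)
      fix e assume "sorts M e = replicate j s @ \<sigma>"
      then have "length (sorts M e) = length (replicate j s @ \<sigma>)" by (rule arg_cong)
      then have j: "j \<le> length e" by simp
      have tk: "(\<forall>i\<in>{..<j}. \<not> (y # e) ! 0 = (y # e) ! Suc i) \<longleftrightarrow> y \<notin> set (take j e)" for y
        using j by (auto simp: in_set_conv_nth)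
      show "(\<exists>y. sort_of M y = s \<and> R (take 1 (y # e) @ drop (1 + j) (y # e)) \<and>
        (\<forall>i\<in>{..<j}. \<not> (y # e) ! 0 = (y # e) ! Suc i) \<and> ?P n (Suc j) (y # e)) = ?P (Suc n) j e"
        (is "?L = ?R")
      proof
        assume ?L
        then obtain y ys where "sort_of M y = s" "R (y # drop j e)" "y \<notin> set (take j e)"
          "distinct ys" "length ys = n" "set ys \<inter> set (take (Suc j) (y # e)) = {}"
          "\<forall>y\<in>set ys. sort_of M y = s \<and> R (y # drop j e)"
          unfolding tk by auto
        then show ?R by (intro exI[of _ "y # ys"]) auto
      next
        assume ?R
        then obtain ys where ys: "distinct ys" "length ys = Suc n"
          "set ys \<inter> set (take j e) = {}" "\<forall>y\<in>set ys. sort_of M y = s \<and> R (y # drop j e)"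
          by auto
        then obtain y zs where "ys = y # zs" by (cases ys) auto
        then show ?L
          unfolding tk using ys by (intro exI[of _ y]) (auto intro!: exI[of _ zs])
      qed
    qed
  qed
  from this[of 0] show ?thesis by simp
qed

section \<open>Solution sets and types\<close>

lemma pforms_E:
  assumes "\<psi> \<in> pforms M \<sigma> A"
  obtains \<phi> b where "\<psi> = (\<sigma>, \<phi>, b)" "set b \<subseteq> A" "is_form M (\<sigma> @ sorts M b) \<phi>"
  using assms by (auto simp: pforms_def)

lemma pforms_iff: "(\<tau>, \<phi>, b) \<in> pforms M \<sigma> A \<longleftrightarrow> \<tau> = \<sigma> \<and> set b \<subseteq> A \<and> is_form M (\<sigma> @ sorts M b) \<phi>"
  by (auto simp: pforms_def)

lemma pforms_mono: "A \<subseteq> B \<Longrightarrow> pforms M \<sigma> A \<subseteq> pforms M \<sigma> B"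
  by (auto simp: pforms_def)

lemma psols_sorts: "\<psi> \<in> pforms M \<sigma> A \<Longrightarrow> a \<in> psols M \<psi> \<Longrightarrow> sorts M a = \<sigma>"
  by (auto elim!: pforms_E)

lemma psols_definable:
  assumes "\<psi> \<in> pforms M \<sigma> A"
  obtains b R where "set b \<subseteq> A" "definable M (\<sigma> @ sorts M b) R"
    "psols M \<psi> = {a. sorts M a = \<sigma> \<and> R (a @ b)}"
proof -
  obtain \<phi> b where *: "\<psi> = (\<sigma>, \<phi>, b)" "set b \<subseteq> A" "is_form M (\<sigma> @ sorts M b) \<phi>"
    using assms by (rule pforms_E)
  show thesis by (rule that[OF *(2) definable_sat[OF *(3)]]) (simp add: *(1))
qed

text \<open>
  The formula does not depend on the parameters but only on their sorts, so that it can be evaluated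
  at conjugates \<open>c\<close> of \<open>b\<close> as well.
\<close>

lemma definable_pform:
  assumes "set b \<subseteq> A" "definable M (\<sigma> @ sorts M b) R"
  obtains \<phi> where "(\<sigma>, \<phi>, b) \<in> pforms M \<sigma> A"
    "\<And>c. sorts M c = sorts M b \<Longrightarrow> psols M (\<sigma>, \<phi>, c) = {a. sorts M a = \<sigma> \<and> R (a @ c)}"
  using assms unfolding definable_def by (auto simp: pforms_iff intro!: that)

lemma pforms_inter:
  assumes "\<psi> \<in> pforms M \<sigma> A" "\<chi> \<in> pforms M \<sigma> A"
  shows "\<exists>\<theta>\<in>pforms M \<sigma> A. psols M \<theta> = psols M \<psi> \<inter> psols M \<chi>"
proof -
  obtain b R where b: "set b \<subseteq> A" "definable M (\<sigma> @ sorts M b) R"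
    "psols M \<psi> = {a. sorts M a = \<sigma> \<and> R (a @ b)}" using assms(1) by (rule psols_definable)
  obtain c Q where c: "set c \<subseteq> A" "definable M (\<sigma> @ sorts M c) Q"
    "psols M \<chi> = {a. sorts M a = \<sigma> \<and> Q (a @ c)}" using assms(2) by (rule psols_definable)
  have 1: "definable M (\<sigma> @ sorts M (b @ c)) (\<lambda>e. R (take (length \<sigma> + length b) e))"
  proof (rule definable_cong)
    show "definable M (\<sigma> @ sorts M (b @ c))
      (\<lambda>e. R (take (length \<sigma> + length b) e @ drop (length \<sigma> + length b + length c) e))"
      using definable_skip[of M "\<sigma> @ sorts M b" "[]" R "sorts M c"] b(2) by simp
    fix e assume "sorts M e = \<sigma> @ sorts M (b @ c)"
    then have "length (sorts M e) = length (\<sigma> @ sorts M (b @ c))" by (rule arg_cong)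
    then show "R (take (length \<sigma> + length b) e @ drop (length \<sigma> + length b + length c) e) =
      R (take (length \<sigma> + length b) e)" by simp
  qed
  have 2: "definable M (\<sigma> @ sorts M (b @ c)) (\<lambda>e. Q (take (length \<sigma>) e @ drop (length \<sigma> + length b) e))"
    using definable_skip[of M "\<sigma>" "sorts M c" Q "sorts M b"] c(2) by simp
  have "set (b @ c) \<subseteq> A" using b(1) c(1) by simp
  from this definable_conj[OF 1 2] obtain \<phi> where \<phi>: "(\<sigma>, \<phi>, b @ c) \<in> pforms M \<sigma> A"
    and *: "\<And>d. sorts M d = sorts M (b @ c) \<Longrightarrow> psols M (\<sigma>, \<phi>, d) = {a. sorts M a = \<sigma> \<and>
     R (take (length \<sigma> + length b) (a @ d)) \<and> Q (take (length \<sigma>) (a @ d) @ drop (length \<sigma> + length b) (a @ d))}"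
    by (rule definable_pform) blast
  have "psols M (\<sigma>, \<phi>, b @ c) = psols M \<psi> \<inter> psols M \<chi>"
    unfolding b(3) c(3) *[OF refl] by auto
  with \<phi> show ?thesis by blast
qed

lemma pforms_True: "(\<sigma>, Neg Bot, []) \<in> pforms M \<sigma> A"
  by (simp add: pforms_iff)

lemma pforms_Inter:
  assumes "finite \<Phi>" "\<Phi> \<subseteq> pforms M \<sigma> A"
  shows "\<exists>\<theta>\<in>pforms M \<sigma> A. psols M \<theta> = {a. sorts M a = \<sigma>} \<inter> (\<Inter>\<psi>\<in>\<Phi>. psols M \<psi>)"
  using assms
proof (induction \<Phi> rule: finite_induct)
  case empty
  show ?case by (rule bexI[OF _ pforms_True]) auto
next
  case (insert \<psi> \<Phi>)
  then obtain \<theta> where "\<theta> \<in> pforms M \<sigma> A" "psols M \<theta> = {a. sorts M a = \<sigma>} \<inter> (\<Inter>\<psi>\<in>\<Phi>. psols M \<psi>)"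
    by auto
  moreover from this obtain \<theta>' where "\<theta>' \<in> pforms M \<sigma> A" "psols M \<theta>' = psols M \<psi> \<inter> psols M \<theta>"
    using pforms_inter[of \<psi> M \<sigma> A \<theta>] insert.prems by auto
  ultimately show ?case by (intro bexI[of _ \<theta>']) auto
qed

fun pneg :: "('s, 'f, 'r, 'm) pform \<Rightarrow> ('s, 'f, 'r, 'm) pform" where
  "pneg (\<sigma>, \<phi>, b) = (\<sigma>, Neg \<phi>, b)"

lemma pneg_in: "\<psi> \<in> pforms M \<sigma> A \<Longrightarrow> pneg \<psi> \<in> pforms M \<sigma> A"
  by (auto simp: pforms_def)

lemma psols_pneg: "\<psi> \<in> pforms M \<sigma> A \<Longrightarrow> psols M (pneg \<psi>) = {a. sorts M a = \<sigma>} - psols M \<psi>"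
  by (auto elim!: pforms_E)

lemma tp_iff: "\<psi> \<in> tp M a A \<longleftrightarrow> \<psi> \<in> pforms M (sorts M a) A \<and> a \<in> psols M \<psi>"
  by (auto simp: tp_def)

lemma tp_sorts:
  assumes "tp M a A = tp M b B"
  shows "sorts M a = sorts M b"
proof -
  have "(sorts M a, Neg Bot, []) \<in> tp M a A" by (simp add: tp_iff pforms_True)
  then have "(sorts M a, Neg Bot, []) \<in> pforms M (sorts M b) B"
    unfolding assms by (simp only: tp_iff)
  then show ?thesis unfolding pforms_iff by (rule conjunct1)
qed

text \<open>
  Every \<open>x \<in> A\<close> occurs in \<open>tp(a/A)\<close> as a dummy parameter of a tautology.
\<close>

lemma tp_params:
  assumes "tp M a A = tp M b B"
  shows "A = B"
proof -
  have *: "x \<in> A \<longleftrightarrow> (sorts M a, Neg Bot, [x]) \<in> tp M a A" for x a A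
    by (auto simp: tp_iff pforms_iff)
  have "x \<in> A \<longleftrightarrow> x \<in> B" for x
    unfolding *[of x A a] *[of x B b] assms tp_sorts[OF assms] by (rule refl)
  then show ?thesis by blast
qed

lemma tp_eq_iff:
  "tp M a A = tp M b A \<longleftrightarrow>
     sorts M a = sorts M b \<and> (\<forall>\<psi>\<in>pforms M (sorts M a) A. a \<in> psols M \<psi> \<longleftrightarrow> b \<in> psols M \<psi>)"
  (is "?L \<longleftrightarrow> ?R")
proof
  assume eq: ?L
  have "a \<in> psols M \<psi> \<longleftrightarrow> b \<in> psols M \<psi>" if "\<psi> \<in> pforms M (sorts M a) A" for \<psi>
    using that tp_iff[of \<psi> M a A] tp_iff[of \<psi> M b A] unfolding eq tp_sorts[OF eq] by blast
  then show ?R using tp_sorts[OF eq] by blast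
next
  assume ?R
  then show ?L by (auto simp: tp_def)
qed

lemma tp_subset_eq:
  assumes "sorts M a = sorts M b" "tp M a A \<subseteq> tp M b A"
  shows "tp M a A = tp M b A"
proof -
  have "a \<in> psols M \<psi>" if "\<psi> \<in> pforms M (sorts M a) A" "b \<in> psols M \<psi>" for \<psi>
  proof (rule ccontr)
    assume "a \<notin> psols M \<psi>"
    then have "pneg \<psi> \<in> tp M a A" using that(1) by (simp add: tp_iff pneg_in psols_pneg)
    then have "b \<in> psols M (pneg \<psi>)" using assms(2) by (auto simp: tp_iff)
    then show False using that by (simp add: psols_pneg)
  qed
  then show ?thesis
    unfolding tp_eq_iff using assms(1) subsetD[OF assms(2)] unfolding tp_iff by blast
qed

lemma tp_mono: "tp M a B = tp M b B \<Longrightarrow> A \<subseteq> B \<Longrightarrow> tp M a A = tp M b A"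
  unfolding tp_eq_iff using pforms_mono[of A B M "sorts M a"] by (metis subsetD)

lemma tp_definable:
  assumes "tp M a A = tp M b A" "set c \<subseteq> A" "definable M (sorts M a @ sorts M c) R"
  shows "R (a @ c) \<longleftrightarrow> R (b @ c)"
proof -
  obtain \<phi> where \<phi>: "(sorts M a, \<phi>, c) \<in> pforms M (sorts M a) A"
    "\<And>d. sorts M d = sorts M c \<Longrightarrow> psols M (sorts M a, \<phi>, d) = {x. sorts M x = sorts M a \<and> R (x @ d)}"
    using assms(2,3) by (rule definable_pform) blast
  have "a \<in> psols M (sorts M a, \<phi>, c) \<longleftrightarrow> b \<in> psols M (sorts M a, \<phi>, c)"
    and "sorts M a = sorts M b"
    using assms(1) \<phi>(1) unfolding tp_eq_iff by blast+
  then show ?thesis unfolding \<phi>(2)[OF refl] mem_Collect_eq by metis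
qed

lemma tp_eq_nth_param:
  assumes "tp M a A = tp M b A" "i < length a" "a ! i \<in> A"
  shows "b ! i = a ! i"
proof -
  have "length a = length b" using arg_cong[OF tp_sorts[OF assms(1)], of length] by simp
  moreover have "definable M (sorts M a @ sorts M [a ! i]) (\<lambda>e. e ! i = e ! length a)"
    by (rule definable_eq) (use assms(2) in \<open>auto simp: nth_append\<close>)
  note tp_definable[OF assms(1) _ this]
  ultimately show ?thesis using assms(2,3) by (simp add: nth_append)
qed

text \<open>
  If strong dividing over \<open>A\<close> is witnessed by a formula with parameters \<open>m\<close> and \<open>d\<close>, where \<open>d\<close> lies in
  \<open>A\<close>, then the conjugates of \<open>md\<close> over \<open>A\<close> that matter for \<open>k\<close>-inconsistency vary in \<open>m\<close> only.
\<close>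

lemma tp_eq_Cons_params:
  assumes "tp M (m # d) A = tp M b A" "set d \<subseteq> A"
  obtains y where "b = y # d" "sort_of M y = sort_of M m"
proof -
  have s: "sorts M (m # d) = sorts M b" using tp_sorts[OF assms(1)] .
  have "length b = Suc (length d)" using arg_cong[OF s, of length] by simp
  then obtain y ys where b: "b = y # ys" "length ys = length d"
    by (cases b) auto
  have "ys = d"
  proof (rule nth_equalityI)
    fix i assume i: "i < length ys"
    then have "d ! i \<in> set d" using b(2) by simp
    then have "d ! i \<in> A" using assms(2) by blast
    then show "ys ! i = d ! i"
      using tp_eq_nth_param[OF assms(1), of "Suc i"] b i by simp
  qed (rule b(2))
  then show thesis using that[of y] s b(1) by simp
qed

lemma tp_finite_conj:
  assumes "finite \<Phi>" "\<Phi> \<subseteq> tp M a A"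
  shows "\<exists>\<theta>\<in>tp M a A. psols M \<theta> \<subseteq> (\<Inter>\<psi>\<in>\<Phi>. psols M \<psi>)"
proof -
  obtain \<theta> where "\<theta> \<in> pforms M (sorts M a) A"
    "psols M \<theta> = {x. sorts M x = sorts M a} \<inter> (\<Inter>\<psi>\<in>\<Phi>. psols M \<psi>)"
    using pforms_Inter[OF assms(1), of M "sorts M a" A] subsetD[OF assms(2)] tp_iff by blast
  moreover have "a \<in> psols M \<psi>" if "\<psi> \<in> \<Phi>" for \<psi>
    using subsetD[OF assms(2) that] by (simp only: tp_iff)
  ultimately have "\<theta> \<in> tp M a A" "psols M \<theta> \<subseteq> (\<Inter>\<psi>\<in>\<Phi>. psols M \<psi>)"
    by (auto simp: tp_iff)
  then show ?thesis by blast
qed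

section \<open>Automorphisms\<close>

lemma automorphism_inj: "automorphism M h \<Longrightarrow> inj h"
  by (auto simp: automorphism_def bij_def)

lemma automorphism_sort: "automorphism M h \<Longrightarrow> sort_of M (h m) = sort_of M m"
  by (auto simp: automorphism_def)

lemma automorphism_sorts: "automorphism M h \<Longrightarrow> sorts M (map h a) = sorts M a"
  by (simp add: automorphism_def)

lemma automorphism_sorts' [simp]: "automorphism M h \<Longrightarrow> map (sort_of M \<circ> h) a = sorts M a"
  by (simp add: automorphism_def)

lemma automorphism_inv:
  assumes "automorphism M h"
  shows "automorphism M (inv h)"
proof -
  have bij: "bij h" using assms by (simp add: automorphism_def)
  have hi: "h (inv h x) = x" for x using bij by (simp add: bij_is_surj surj_f_inv_f)
  have ih: "inv h (h x) = x" for x using bij by (simp add: bij_is_inj)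
  have s: "sort_of M (inv h x) = sort_of M x" for x
    using automorphism_sort[OF assms, of "inv h x"] by (simp add: hi)
  have ss: "sorts M (map (inv h) xs) = sorts M xs" for xs by (simp add: s)
  have m: "map h (map (inv h) xs) = xs" for xs by (simp add: hi comp_def)
  have f: "inv h (fun_int M f xs) = fun_int M f (map (inv h) xs)"
    if "fun_arity M f = Some (sorts M xs, s)" for f s xs
  proof -
    have "h (fun_int M f (map (inv h) xs)) = fun_int M f (map h (map (inv h) xs))"
      using assms that ss unfolding automorphism_def by blast
    then show ?thesis using ih m by metis
  qed
  have r: "rel_int M r (map (inv h) xs) \<longleftrightarrow> rel_int M r xs"
    if "rel_arity M r = Some (sorts M xs)" for r xs
  proof -
    have "rel_int M r (map h (map (inv h) xs)) \<longleftrightarrow> rel_int M r (map (inv h) xs)"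
      using assms that ss unfolding automorphism_def by blast
    then show ?thesis using m by metis
  qed
  show ?thesis
    unfolding automorphism_def using bij s f r by (auto simp: bij_imp_bij_inv)
qed

lemma trm_val_sort:
  assumes "trm_sort M \<Gamma> t s" "is_struct M" "sorts M e = \<Gamma>"
  shows "sort_of M (trm_val M e t) = s"
  using assms
proof (induction rule: trm_sort.induct)
  case (2 f ss s ts)
  then have "sorts M (map (trm_val M e) ts) = ss"
    by (auto simp: list_all2_conv_all_nth intro!: nth_equalityI)
  then show ?case using 2 by (auto simp: is_struct_def)
qed auto

lemma automorphism_trm_val:
  assumes "trm_sort M \<Gamma> t s" "automorphism M h" "is_struct M" "sorts M e = \<Gamma>"
  shows "trm_val M (map h e) t = h (trm_val M e t)"
  using assms
proof (induction rule: trm_sort.induct)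
  case (2 f ss s ts)
  have "sorts M (map (trm_val M e) ts) = ss"
    using 2(2-) by (auto simp: list_all2_conv_all_nth trm_val_sort intro!: nth_equalityI)
  then have "h (fun_int M f (map (trm_val M e) ts)) = fun_int M f (map h (map (trm_val M e) ts))"
    using 2(1,3) by (auto simp: automorphism_def)
  moreover have "map (trm_val M (map h e)) ts = map h (map (trm_val M e) ts)"
    using 2(2-) by (auto simp: list_all2_conv_all_nth in_set_conv_nth)
  ultimately show ?case by (simp only: trm_val.simps)
qed auto

lemma automorphism_sat:
  assumes h: "automorphism M h" and st: "is_struct M"
  shows "is_form M (sorts M e) \<phi> \<Longrightarrow> sat M (map h e) \<phi> \<longleftrightarrow> sat M e \<phi>"
proof (induction \<phi> arbitrary: e)
  case (Eq t u)
  then show ?case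
    using automorphism_inj[OF h] by (auto simp: automorphism_trm_val[OF _ h st] inj_eq)
next
  case (Rel r ts)
  then obtain ss where ss: "rel_arity M r = Some ss" "list_all2 (trm_sort M (sorts M e)) ts ss"
    by auto
  have "trm_val M (map h e) t = h (trm_val M e t)" if "t \<in> set ts" for t
    using ss(2) that automorphism_trm_val[OF _ h st refl]
    by (metis in_set_conv_nth list_all2_conv_all_nth)
  then have "map (trm_val M (map h e)) ts = map h (map (trm_val M e) ts)" by simp
  moreover have "sorts M (map (trm_val M e) ts) = ss"
    using ss(2) by (auto simp: list_all2_conv_all_nth trm_val_sort[OF _ st] intro!: nth_equalityI)
  ultimately show ?case
    using h ss(1) unfolding automorphism_def by (metis sat.simps(3))
next
  case (Ex s \<phi>)
  have hi: "h (inv h x) = x" for x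
    using h by (simp add: automorphism_def bij_is_surj surj_f_inv_f)
  have *: "sat M (h m # map h e) \<phi> \<longleftrightarrow> sat M (m # e) \<phi>" if "sort_of M m = s" for m
    using Ex(1)[of "m # e"] Ex(2) that by simp
  have "(\<exists>m. sort_of M m = s \<and> sat M (m # map h e) \<phi>) \<longleftrightarrow>
    (\<exists>m. sort_of M (h m) = s \<and> sat M (h m # map h e) \<phi>)"
    using hi by metis
  then show ?case
    using * automorphism_sort[OF h] by auto
qed auto

fun act :: "('m \<Rightarrow> 'm) \<Rightarrow> ('s, 'f, 'r, 'm) pform \<Rightarrow> ('s, 'f, 'r, 'm) pform" where
  "act h (\<sigma>, \<phi>, b) = (\<sigma>, \<phi>, map h b)"

lemma act_act: "act g (act h \<psi>) = act (g \<circ> h) \<psi>"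
  by (cases \<psi>) simp

lemma fst_act [simp]: "fst (act h \<psi>) = fst \<psi>"
  by (cases \<psi>) simp

lemma act_id [simp]: "act id \<psi> = \<psi>"
  by (cases \<psi>) simp

lemma inv_o_automorphism: "automorphism M h \<Longrightarrow> inv h \<circ> h = id"
  by (simp add: automorphism_inj)

lemma o_inv_automorphism: "automorphism M h \<Longrightarrow> h \<circ> inv h = id"
  by (simp add: automorphism_def bij_def flip: surj_iff)

lemma pforms_act: "automorphism M h \<Longrightarrow> act h \<psi> \<in> pforms M \<sigma> (h ` A) \<longleftrightarrow> \<psi> \<in> pforms M \<sigma> A"
  by (cases \<psi>) (auto simp: pforms_iff inj_image_subset_iff automorphism_inj automorphism_sorts simp del: map_map)

lemma psols_act:
  assumes "automorphism M h" "is_struct M" "\<psi> \<in> pforms M \<sigma> A"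
  shows "map h a \<in> psols M (act h \<psi>) \<longleftrightarrow> a \<in> psols M \<psi>"
proof -
  obtain \<phi> b where \<psi>: "\<psi> = (\<sigma>, \<phi>, b)" "is_form M (\<sigma> @ sorts M b) \<phi>"
    using assms(3) by (rule pforms_E)
  show ?thesis
    using automorphism_sat[OF assms(1,2), of "a @ b" \<phi>] \<psi>(2)
    unfolding \<psi>(1) act.simps psols.simps mem_Collect_eq automorphism_sorts[OF assms(1)] map_append
    by metis
qed

lemma psols_act_image:
  assumes "automorphism M h" "is_struct M" "\<psi> \<in> pforms M \<sigma> A"
  shows "psols M (act h \<psi>) = map h ` psols M \<psi>"
proof -
  have "a \<in> map h ` psols M \<psi>" if "a \<in> psols M (act h \<psi>)" for a
  proof -
    have "a = map h (map (inv h) a)" using o_inv_automorphism[OF assms(1)] by (simp)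
    then show ?thesis using psols_act[OF assms] that by (metis imageI)
  qed
  then show ?thesis using psols_act[OF assms] by blast
qed

lemma tp_act:
  assumes "automorphism M h" "is_struct M"
  shows "tp M (map h a) (h ` A) = act h ` tp M a A"
proof -
  have "\<psi> \<in> act h ` tp M a A" if "\<psi> \<in> tp M (map h a) (h ` A)" for \<psi>
  proof -
    have *: "\<psi> = act h (act (inv h) \<psi>)" by (simp add: act_act o_inv_automorphism[OF assms(1)])
    have "act (inv h) \<psi> \<in> pforms M (sorts M a) A"
      using that pforms_act[OF assms(1), of "act (inv h) \<psi>"] assms(1) by (simp add: tp_iff flip: *)
    moreover from this have "a \<in> psols M (act (inv h) \<psi>)"
      using that psols_act[OF assms, of "act (inv h) \<psi>" _ _ a] by (simp add: tp_iff flip: *)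
    ultimately show ?thesis using * by (auto simp: tp_iff)
  qed
  moreover have "act h \<psi> \<in> tp M (map h a) (h ` A)" if "\<psi> \<in> tp M a A" for \<psi>
    using that assms by (auto simp: tp_iff pforms_act psols_act automorphism_sorts simp del: map_map)
  ultimately show ?thesis by blast
qed

definition aut_over :: "('s, 'f, 'r, 'm) fo_struct \<Rightarrow> 'm set \<Rightarrow> ('m \<Rightarrow> 'm) \<Rightarrow> bool" where
  "aut_over M A h \<longleftrightarrow> automorphism M h \<and> (\<forall>x\<in>A. h x = x)"

lemma aut_over_mono: "aut_over M B h \<Longrightarrow> A \<subseteq> B \<Longrightarrow> aut_over M A h"
  by (auto simp: aut_over_def)

lemma aut_over_image: "aut_over M A h \<Longrightarrow> h ` A = A"
  by (auto simp: aut_over_def)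

lemma aut_over_inv:
  assumes "aut_over M A h"
  shows "aut_over M A (inv h)"
proof -
  have "inv h x = x" if "x \<in> A" for x
    using assms that by (auto simp: aut_over_def inv_f_eq automorphism_inj)
  then show ?thesis using assms by (simp add: aut_over_def automorphism_inv)
qed

lemma tp_aut_over:
  assumes "aut_over M A h" "is_struct M"
  shows "tp M (map h a) A = tp M a A"
proof -
  have "act h \<psi> = \<psi>" if "\<psi> \<in> tp M a A" for \<psi>
    using assms(1) that by (auto simp: tp_def pforms_def aut_over_def subset_iff intro!: map_idI)
  then have "act h ` tp M a A = tp M a A" by simp
  then show ?thesis
    using tp_act[of M h a A] assms aut_over_image[OF assms(1)] by (simp add: aut_over_def)
qed

section \<open>Algebraic closure\<close>

lemma acl_mono: "A \<subseteq> B \<Longrightarrow> acl M A \<subseteq> acl M B"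
  unfolding acl_def using pforms_mono by blast

lemma acl_I:
  assumes "definable M (sort_of M m # sorts M p) R" "R (m # p)"
    "finite {y. sort_of M y = sort_of M m \<and> R (y # p)}" "set p \<subseteq> A"
  shows "m \<in> acl M A"
proof -
  have "definable M ([sort_of M m] @ sorts M p) R" using assms(1) by simp
  with assms(4) obtain \<phi> where \<phi>: "([sort_of M m], \<phi>, p) \<in> pforms M [sort_of M m] A"
    "\<And>c. sorts M c = sorts M p \<Longrightarrow>
      psols M ([sort_of M m], \<phi>, c) = {a. sorts M a = [sort_of M m] \<and> R (a @ c)}"
    by (rule definable_pform) blast
  have *: "psols M ([sort_of M m], \<phi>, p) = (\<lambda>y. [y]) ` {y. sort_of M y = sort_of M m \<and> R (y # p)}"
    unfolding \<phi>(2)[OF refl] by (auto simp: map_eq_Cons_conv)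
  show ?thesis
    unfolding acl_def using \<phi>(1) * assms(2,3) by (auto intro!: bexI[of _ "([sort_of M m], \<phi>, p)"])
qed

lemma acl_E:
  assumes "m \<in> acl M A"
  obtains p R where "set p \<subseteq> A" "definable M (sort_of M m # sorts M p) R" "R (m # p)"
    "finite {y. sort_of M y = sort_of M m \<and> R (y # p)}"
proof -
  obtain \<psi> where \<psi>: "\<psi> \<in> pforms M [sort_of M m] A" "[m] \<in> psols M \<psi>" "finite (psols M \<psi>)"
    using assms by (auto simp: acl_def)
  obtain p R where p: "set p \<subseteq> A" "definable M ([sort_of M m] @ sorts M p) R"
    "psols M \<psi> = {a. sorts M a = [sort_of M m] \<and> R (a @ p)}"
    using \<psi>(1) by (rule psols_definable)
  have "(\<lambda>y. [y]) ` {y. sort_of M y = sort_of M m \<and> R (y # p)} \<subseteq> psols M \<psi>"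
    unfolding p(3) by auto
  then have "finite ((\<lambda>y. [y]) ` {y. sort_of M y = sort_of M m \<and> R (y # p)})"
    using \<psi>(3) finite_subset by blast
  then have "finite {y. sort_of M y = sort_of M m \<and> R (y # p)}"
    by (rule finite_imageD) (simp add: inj_on_def)
  moreover have "R (m # p)" using \<psi>(2) unfolding p(3) by simp
  ultimately show thesis using that[OF p(1)] p(2) by simp
qed

lemma subset_acl: "A \<subseteq> acl M A"
proof
  fix m assume "m \<in> A"
  have "definable M (sort_of M m # sorts M [m]) (\<lambda>e. e ! 0 = e ! 1)"
    by (rule definable_eq) auto
  then show "m \<in> acl M A" by (rule acl_I) (use \<open>m \<in> A\<close> in auto)
qed

section \<open>Saturation and homogeneity\<close>

locale monster =
  fixes T :: "('s, 'f, 'r) fm set" and M :: "('s, 'f, 'r, 'm) fo_struct" and \<kappa> :: "'k rel"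
  assumes monster: "monster_model T M \<kappa>"
begin

lemma is_struct: "is_struct M"
  using monster by (simp add: monster_model_def models_def)

text \<open>
  The sentences \<open>\<not>\<^sup>i\<bottom>\<close> are pairwise distinct, and the complete theory decides each of them. This
  makes \<open>\<kappa>\<close> infinite, which is why small sets are closed under finite unions.
\<close>

lemma infinite_T: "infinite T"
proof
  assume fin: "finite T"
  define f :: "nat \<Rightarrow> ('s, 'f, 'r) fm" where "f n = (Neg ^^ (2 * n)) Bot" for n
  have inj0: "(Neg ^^ m) Bot = (Neg ^^ n) (Bot :: ('s, 'f, 'r) fm) \<longleftrightarrow> m = n" for m n :: nat
  proof (induction m arbitrary: n)
    case 0
    then show ?case by (cases n) auto
  next
    case (Suc m)
    then show ?case by (cases n) auto
  qed
  define g where "g n = (if f n \<in> T then f n else Neg (f n))" for n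
  have form: "is_form M [] (f n)" for n
  proof -
    have "is_form M [] ((Neg ^^ m) Bot)" for m by (induction m) auto
    then show ?thesis by (simp add: f_def)
  qed
  have "g n \<in> T" for n
    using monster form[of n] by (auto simp: g_def monster_model_def complete_theory_def)
  moreover have "inj g"
  proof (rule injI)
    fix m n assume "g m = g n"
    moreover have "\<exists>i. g k = (Neg ^^ i) Bot \<and> k = i div 2" for k
      using exI[of "\<lambda>i. g k = (Neg ^^ i) Bot \<and> k = i div 2" "2 * k"]
        exI[of "\<lambda>i. g k = (Neg ^^ i) Bot \<and> k = i div 2" "Suc (2 * k)"]
      by (auto simp: g_def f_def)
    ultimately show "m = n" by (metis inj0)
  qed
  ultimately have "infinite T"
    using infinite_iff_countable_subset by blast
  then show False using fin by simp
qed

lemma Card_order: "Card_order \<kappa>"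
  using monster by (simp add: monster_model_def)

lemma infinite_Field: "infinite (Field \<kappa>)"
proof
  assume "finite (Field \<kappa>)"
  moreover have "|Pow T| \<le>o \<kappa>"
    using monster by (simp add: monster_model_def ordLess_imp_ordLeq)
  then have "|Pow T| \<le>o |Field \<kappa>|"
    using card_of_Field_ordIso[OF Card_order] ordIso_symmetric ordLeq_ordIso_trans by blast
  ultimately have "finite (Pow T)" using card_of_ordLeq_finite by blast
  then show False using infinite_T by simp
qed

lemma small_Un: "small \<kappa> A \<Longrightarrow> small \<kappa> B \<Longrightarrow> small \<kappa> (A \<union> B)"
  unfolding small_def by (rule card_of_Un_ordLess_infinite_Field[OF infinite_Field Card_order])

lemma small_finite:
  assumes "finite A"
  shows "small \<kappa> A"
proof -
  have "|A| <o \<kappa>"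
    by (rule finite_ordLess_infinite)
      (use assms infinite_Field Card_order in \<open>auto simp: card_order_on_well_order_on card_of_well_order_on Field_card_of\<close>)
  then show ?thesis by (simp add: small_def)
qed

lemma small_subset: "small \<kappa> B \<Longrightarrow> A \<subseteq> B \<Longrightarrow> small \<kappa> A"
  unfolding small_def using card_of_mono1 ordLeq_ordLess_trans by blast

lemma small_image: "small \<kappa> A \<Longrightarrow> small \<kappa> (h ` A)"
  unfolding small_def using card_of_image ordLeq_ordLess_trans by blast

lemma small_Un_finite [simp]: "finite B \<Longrightarrow> small \<kappa> (A \<union> B) \<longleftrightarrow> small \<kappa> A"
  using small_Un[of A B] small_finite[of B] small_subset[of "A \<union> B" A] by blast

lemma small_insert [simp]: "small \<kappa> (insert x A) \<longleftrightarrow> small \<kappa> A"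
  using small_Un[of "{x}" A] small_finite[of "{x}"] small_subset[of "insert x A" A] by auto

text \<open>
  Saturation, restated for coverings: if a partial type over a small set implies a disjunction of
  formulas over it, then a finite part of the type implies a finite part of the disjunction.
\<close>

lemma compactness:
  assumes A: "small \<kappa> A" and p: "p \<subseteq> pforms M \<sigma> A" and C: "C \<subseteq> pforms M \<sigma> A"
    and cover: "\<And>a. sorts M a = \<sigma> \<Longrightarrow> (\<And>\<psi>. \<psi> \<in> p \<Longrightarrow> a \<in> psols M \<psi>) \<Longrightarrow> \<exists>\<chi>\<in>C. a \<in> psols M \<chi>"
  shows "\<exists>p0 C0. finite p0 \<and> p0 \<subseteq> p \<and> finite C0 \<and> C0 \<subseteq> C \<and>
    (\<forall>a. sorts M a = \<sigma> \<and> (\<forall>\<psi>\<in>p0. a \<in> psols M \<psi>) \<longrightarrow> (\<exists>\<chi>\<in>C0. a \<in> psols M \<chi>))"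
proof -
  have neg: "a \<in> psols M (pneg \<chi>) \<longleftrightarrow> a \<notin> psols M \<chi>" if "sorts M a = \<sigma>" "\<chi> \<in> C" for a \<chi>
    using psols_pneg[OF subsetD[OF C that(2)]] that(1) by blast
  have sub: "p \<union> pneg ` C \<subseteq> pforms M \<sigma> A"
    using p subsetD[OF C] pneg_in by blast
  have "\<not> (\<exists>a. sorts M a = \<sigma> \<and> (\<forall>\<psi>\<in>p \<union> pneg ` C. a \<in> psols M \<psi>))"
    using cover neg by blast
  moreover have sat: "\<exists>a. sorts M a = \<sigma> \<and> (\<forall>\<psi>\<in>\<Phi>. a \<in> psols M \<psi>)"
    if "\<Phi> \<subseteq> pforms M \<sigma> A"
      "\<And>\<Phi>'. \<Phi>' \<subseteq> \<Phi> \<Longrightarrow> finite \<Phi>' \<Longrightarrow> \<exists>a. sorts M a = \<sigma> \<and> (\<forall>\<psi>\<in>\<Phi>'. a \<in> psols M \<psi>)" for \<Phi>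
  proof -
    have "saturated M \<kappa>" using monster by (simp add: monster_model_def)
    from this[unfolded saturated_def, THEN spec, THEN spec, THEN spec, of A \<Phi> \<sigma>]
    show ?thesis using A that by blast
  qed
  ultimately obtain \<Phi> where \<Phi>: "\<Phi> \<subseteq> p \<union> pneg ` C" "finite \<Phi>"
    "\<not> (\<exists>a. sorts M a = \<sigma> \<and> (\<forall>\<psi>\<in>\<Phi>. a \<in> psols M \<psi>))"
    using sat[OF sub] by blast
  obtain C0 where C0: "C0 \<subseteq> C" "finite C0" "\<Phi> \<inter> pneg ` C = pneg ` C0"
    using finite_subset_image[of "\<Phi> \<inter> pneg ` C" pneg C] \<Phi>(2) by blast
  have "\<exists>\<chi>\<in>C0. a \<in> psols M \<chi>" if a: "sorts M a = \<sigma>" "\<forall>\<psi>\<in>\<Phi> \<inter> p. a \<in> psols M \<psi>" for a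
  proof -
    obtain \<psi> where "\<psi> \<in> \<Phi>" "a \<notin> psols M \<psi>" using \<Phi>(3) a(1) by blast
    then have "\<psi> \<in> pneg ` C0" using \<Phi>(1) a(2) C0(3) by blast
    then show "\<exists>\<chi>\<in>C0. a \<in> psols M \<chi>"
      using \<open>a \<notin> psols M \<psi>\<close> neg[OF a(1)] C0(1) by blast
  qed
  then show ?thesis
    using C0(1,2) \<Phi>(2) by (intro exI[of _ "\<Phi> \<inter> p"] exI[of _ C0]) blast
qed

text \<open>
  For a complete type the finite part can be taken to be a single formula.
\<close>

lemma tp_cover:
  assumes A: "small \<kappa> A" and B: "small \<kappa> B" and C: "C \<subseteq> pforms M (sorts M a) B"
    and cover: "\<And>b. tp M b A = tp M a A \<Longrightarrow> \<exists>\<chi>\<in>C. b \<in> psols M \<chi>"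
  obtains \<theta> C0 where "\<theta> \<in> tp M a A" "finite C0" "C0 \<subseteq> C" "psols M \<theta> \<subseteq> (\<Union>\<chi>\<in>C0. psols M \<chi>)"
proof -
  have 1: "tp M a A \<subseteq> pforms M (sorts M a) (A \<union> B)"
    using pforms_mono[of A "A \<union> B" M "sorts M a"] unfolding tp_def by blast
  have 2: "C \<subseteq> pforms M (sorts M a) (A \<union> B)"
    using C pforms_mono[of B "A \<union> B" M "sorts M a"] by blast
  have 3: "\<exists>\<chi>\<in>C. b \<in> psols M \<chi>"
    if "sorts M b = sorts M a" "\<And>\<psi>. \<psi> \<in> tp M a A \<Longrightarrow> b \<in> psols M \<psi>" for b
  proof (rule cover, rule sym, rule tp_subset_eq)
    show "sorts M a = sorts M b" using that(1) by (rule sym)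
    show "tp M a A \<subseteq> tp M b A"
      using that(2) unfolding tp_iff subset_iff that(1) by blast
  qed
  have "\<exists>p0 C0. finite p0 \<and> p0 \<subseteq> tp M a A \<and> finite C0 \<and> C0 \<subseteq> C \<and>
    (\<forall>b. sorts M b = sorts M a \<and> (\<forall>\<psi>\<in>p0. b \<in> psols M \<psi>) \<longrightarrow> (\<exists>\<chi>\<in>C0. b \<in> psols M \<chi>))"
    by (rule compactness[OF small_Un[OF A B] 1 2]) (rule 3)
  then obtain p0 C0 where *: "finite p0" "p0 \<subseteq> tp M a A" "finite C0" "C0 \<subseteq> C"
    "\<forall>b. sorts M b = sorts M a \<and> (\<forall>\<psi>\<in>p0. b \<in> psols M \<psi>) \<longrightarrow> (\<exists>\<chi>\<in>C0. b \<in> psols M \<chi>)"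
    by blast
  obtain \<theta> where \<theta>: "\<theta> \<in> tp M a A" "psols M \<theta> \<subseteq> (\<Inter>\<psi>\<in>p0. psols M \<psi>)"
    using tp_finite_conj[OF *(1,2)] by blast
  have "\<exists>\<chi>\<in>C0. b \<in> psols M \<chi>" if b: "b \<in> psols M \<theta>" for b
  proof -
    have "sorts M b = sorts M a"
      using psols_sorts[of \<theta> M "sorts M a" A] \<theta>(1) b unfolding tp_iff by blast
    moreover have "\<forall>\<psi>\<in>p0. b \<in> psols M \<psi>" using \<theta>(2) b by blast
    ultimately show ?thesis using *(5) by blast
  qed
  then show thesis using that[OF \<theta>(1) *(3,4)] by blast
qed

text \<open>
  The map that fixes \<open>A\<close> and sends \<open>a\<close> to \<open>b\<close> is well defined and elementary, because equalities
  among the entries of \<open>a\<close> and the elements of \<open>A\<close> are recorded in the type.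
\<close>

lemma homogeneity:
  assumes A: "small \<kappa> A" and eq: "tp M a A = tp M b A"
  obtains h where "aut_over M A h" "map h a = b"
proof -
  have len: "length a = length b" using arg_cong[OF tp_sorts[OF eq], of length] by simp
  have sab: "sort_of M (b ! i) = sort_of M (a ! i)" if "i < length a" for i
    using arg_cong[OF tp_sorts[OF eq], of "\<lambda>l. l ! i"] that len by simp
  have eqs: "b ! i = b ! j" if "i < length a" "j < length a" "a ! i = a ! j" for i j
  proof -
    have "definable M (sorts M a @ sorts M []) (\<lambda>e. e ! i = e ! j)"
      by (rule definable_eq) (use that in auto)
    from tp_definable[OF eq _ this] show ?thesis using that len by simp
  qed
  have fixA: "b ! i = a ! i" if "i < length a" "a ! i \<in> A" for i
    using tp_eq_nth_param[OF eq that] .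
  define g where "g m = (if m \<in> set a then b ! (SOME i. i < length a \<and> a ! i = m) else m)" for m
  have ga: "g (a ! i) = b ! i" if "i < length a" for i
  proof -
    let ?j = "SOME j. j < length a \<and> a ! j = a ! i"
    have "?j < length a \<and> a ! ?j = a ! i" by (rule someI_ex) (use that in blast)
    then have "b ! ?j = b ! i" using eqs that by blast
    then show ?thesis unfolding g_def if_P[OF nth_mem[OF that]] .
  qed
  have gA: "g m = m" if "m \<in> A" for m
  proof (cases "m \<in> set a")
    case True
    then obtain i where "i < length a" "m = a ! i" by (auto simp: in_set_conv_nth)
    then show ?thesis using ga fixA that by metis
  qed (simp add: g_def)
  have "partial_elementary M (A \<union> set a) g"
    unfolding partial_elementary_def
  proof (intro allI impI)
    fix c assume c: "set c \<subseteq> A \<union> set a"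
    \<comment> \<open>A formula about \<open>c\<close> is rewritten as a formula about \<open>a\<close> with parameters \<open>d\<close> in \<open>A\<close>.\<close>
    define d where "d = filter (\<lambda>x. x \<in> A) c"
    have "\<exists>j. j < length (a @ d) \<and> (a @ d) ! j = c ! i" if "i < length c" for i
    proof -
      have "c ! i \<in> set (a @ d)" using c nth_mem[OF that] by (auto simp: d_def)
      then show ?thesis by (metis in_set_conv_nth)
    qed
    then obtain r where r: "\<And>i. i < length c \<Longrightarrow> r i < length (a @ d) \<and> (a @ d) ! r i = c ! i"
      by metis
    have cp: "pull r (length c) (a @ d) = c"
      by (rule nth_equalityI) (use r in auto)
    have gd: "map g (a @ d) = b @ d"
    proof -
      have "map g a = b" by (rule nth_equalityI) (use len ga in auto)
      moreover have "map g d = d" by (rule map_idI) (simp add: gA d_def)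
      ultimately show ?thesis by simp
    qed
    have gcp: "pull r (length c) (b @ d) = map g c"
    proof (rule nth_equalityI)
      fix i assume "i < length (pull r (length c) (b @ d))"
      then have i: "i < length c" by simp
      then show "pull r (length c) (b @ d) ! i = map g c ! i"
        using r[OF i] gd nth_map[of "r i" "a @ d" g] by simp
    qed simp
    have sg: "sort_of M (g m) = sort_of M m" for m
    proof (cases "m \<in> set a")
      case True
      then obtain i where "i < length a" "m = a ! i" by (auto simp: in_set_conv_nth)
      then show ?thesis using ga sab by simp
    qed (simp add: g_def)
    have sc: "sorts M (map g c) = sorts M c" by (simp add: sg)
    have "map g c \<in> psols M \<psi> \<longleftrightarrow> c \<in> psols M \<psi>" if \<psi>: "\<psi> \<in> pforms M (sorts M (map g c)) {}" for \<psi>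
    proof -
      obtain \<phi> where \<phi>: "\<psi> = (sorts M c, \<phi>, [])" "is_form M (sorts M c) \<phi>"
        using \<psi> unfolding sc by (auto simp: pforms_def)
      have "definable M (sorts M a @ sorts M d) (\<lambda>e. sat M (pull r (length (sorts M c)) e) \<phi>)"
        using definable_rearrange[OF definable_sat[OF \<phi>(2)], of c "a @ d" r] r by simp
      from tp_definable[OF eq _ this] have "sat M c \<phi> \<longleftrightarrow> sat M (map g c) \<phi>"
        using cp gcp by (auto simp: d_def)
      then show ?thesis unfolding \<phi>(1) psols.simps mem_Collect_eq append_Nil2 sc by blast
    qed
    then show "tp M (map g c) {} = tp M c {}"
      unfolding tp_eq_iff using sc by blast
  qed
  moreover have "small \<kappa> (A \<union> set a)" using A by simp
  moreover have "strongly_homogeneous M \<kappa>" using monster by (simp add: monster_model_def)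
  ultimately obtain h where h: "automorphism M h" "\<forall>m\<in>A \<union> set a. h m = g m"
    unfolding strongly_homogeneous_def by blast
  show thesis
  proof (rule that)
    show "aut_over M A h" using h gA by (auto simp: aut_over_def)
    show "map h a = b" by (rule nth_equalityI) (use len h(2) ga in auto)
  qed
qed

section \<open>Algebraic closure and orbits\<close>

lemma acl_aut:
  assumes "automorphism M h" "m \<in> acl M A"
  shows "h m \<in> acl M (h ` A)"
proof -
  obtain \<psi> where \<psi>: "\<psi> \<in> pforms M [sort_of M m] A" "[m] \<in> psols M \<psi>" "finite (psols M \<psi>)"
    using assms(2) by (auto simp: acl_def)
  have "act h \<psi> \<in> pforms M [sort_of M (h m)] (h ` A)"
    unfolding automorphism_sort[OF assms(1)] pforms_act[OF assms(1)] by (rule \<psi>(1))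
  moreover have "finite (psols M (act h \<psi>))"
    using psols_act_image[OF assms(1) is_struct \<psi>(1)] \<psi>(3) by simp
  moreover have "[h m] \<in> psols M (act h \<psi>)"
    using psols_act[OF assms(1) is_struct \<psi>(1), of "[m]"] \<psi>(2) by simp
  ultimately show ?thesis unfolding acl_def by blast
qed

lemma acl_aut_iff:
  assumes "automorphism M h"
  shows "h m \<in> acl M (h ` A) \<longleftrightarrow> m \<in> acl M A"
proof
  assume "h m \<in> acl M (h ` A)"
  from acl_aut[OF automorphism_inv[OF assms] this] show "m \<in> acl M A"
    using automorphism_inj[OF assms] by (simp add: image_image)
qed (rule acl_aut[OF assms])

text \<open>
  If the orbit of \<open>m\<close> is finite, then \<open>tp(m/A)\<close> implies the finite disjunction of the formulas \<open>x = o\<close>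
  for \<open>o\<close> in the orbit. By compactness a single formula of the type does so, and it is algebraic.
\<close>

lemma acl_orbit:
  assumes "small \<kappa> A"
  shows "m \<in> acl M A \<longleftrightarrow> finite {h m | h. aut_over M A h}" (is "_ \<longleftrightarrow> finite ?O")
proof
  assume "m \<in> acl M A"
  then obtain \<psi> where \<psi>: "\<psi> \<in> pforms M [sort_of M m] A" "[m] \<in> psols M \<psi>" "finite (psols M \<psi>)"
    by (auto simp: acl_def)
  have "(\<lambda>y. [y]) ` ?O \<subseteq> psols M \<psi>"
  proof -
    have "[h m] \<in> psols M \<psi>" if "aut_over M A h" for h
      using tp_aut_over[OF that is_struct, of "[m]"] \<psi>(1,2) unfolding tp_eq_iff by auto
    then show ?thesis by blast
  qed
  then have "finite ((\<lambda>y. [y]) ` ?O)" using \<psi>(3) finite_subset by blast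
  then show "finite ?O" by (rule finite_imageD) (simp add: inj_on_def)
next
  assume fin: "finite ?O"
  define C :: "('s, 'f, 'r, 'm) pform set" where
    "C = (\<lambda>y. ([sort_of M m], Eq (Var 0) (Var 1), [y])) ` ?O"
  have sort: "sort_of M y = sort_of M m" if "y \<in> ?O" for y
    using that automorphism_sort by (auto simp: aut_over_def)
  have C: "C \<subseteq> pforms M (sorts M [m]) ?O"
  proof -
    have "trm_sort M [sort_of M m, sort_of M m] (Var 0) (sort_of M m)"
      "trm_sort M [sort_of M m, sort_of M m] (Var 1) (sort_of M m)"
      using trm_sort.intros(1)[of 0 "[sort_of M m, sort_of M m]" M]
        trm_sort.intros(1)[of 1 "[sort_of M m, sort_of M m]" M] by auto
    then have "is_form M [sort_of M m, sort_of M m] (Eq (Var 0) (Var 1))" by auto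
    then have "([sort_of M m], Eq (Var 0) (Var 1), [y]) \<in> pforms M (sorts M [m]) ?O" if "y \<in> ?O" for y
      unfolding pforms_iff using that sort[OF that] by simp
    then show ?thesis unfolding C_def by (rule image_subsetI)
  qed
  have cover: "\<exists>\<chi>\<in>C. b \<in> psols M \<chi>" if eq: "tp M b A = tp M [m] A" for b
  proof -
    obtain h where h: "aut_over M A h" "map h [m] = b"
      by (rule homogeneity[OF assms sym[OF eq]])
    then have "b = [h m]" "h m \<in> ?O" by auto
    then show ?thesis unfolding C_def using sort[of "h m"] by auto
  qed
  obtain \<theta> C0 where \<theta>: "\<theta> \<in> tp M [m] A" "finite C0" "C0 \<subseteq> C" "psols M \<theta> \<subseteq> (\<Union>\<chi>\<in>C0. psols M \<chi>)"
    by (rule tp_cover[OF assms small_finite[OF fin] C cover])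
  have "(\<Union>\<chi>\<in>C0. psols M \<chi>) \<subseteq> (\<Union>\<chi>\<in>C. psols M \<chi>)"
    by (rule UN_mono[OF \<theta>(3) subset_refl])
  also have "\<dots> \<subseteq> (\<lambda>y. [y]) ` ?O"
    unfolding C_def by (auto simp: map_eq_Cons_conv)
  finally have "psols M \<theta> \<subseteq> (\<lambda>y. [y]) ` ?O" by (rule subset_trans[OF \<theta>(4)])
  then have "finite (psols M \<theta>)" by (rule finite_subset) (rule finite_imageI[OF fin])
  moreover have "\<theta> \<in> pforms M [sort_of M m] A" "[m] \<in> psols M \<theta>"
    using \<theta>(1) unfolding tp_iff by simp_all
  ultimately show "m \<in> acl M A" unfolding acl_def by blast
qed

text \<open>
  Transitivity of algebraic closure. An algebraic formula for \<open>m\<close> has parameters \<open>b\<close> in \<open>acl(A)\<close>. So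
  \<open>b\<close> has finitely many conjugates over \<open>A\<close>, and each of them admits only finitely many
  conjugates of \<open>m\<close>.
\<close>

lemma acl_subset_acl:
  assumes "small \<kappa> A" "B \<subseteq> acl M A"
  shows "acl M B \<subseteq> acl M A"
proof
  fix m assume "m \<in> acl M B"
  then obtain \<psi> where \<psi>: "\<psi> \<in> pforms M [sort_of M m] B" "[m] \<in> psols M \<psi>" "finite (psols M \<psi>)"
    by (auto simp: acl_def)
  obtain \<phi> b where b: "\<psi> = ([sort_of M m], \<phi>, b)" "set b \<subseteq> B"
    using \<psi>(1) by (rule pforms_E)
  let ?L = "{map h b | h. aut_over M A h}"
  let ?O = "\<lambda>x. {h x | h. aut_over M A h}"
  have "finite (?O x)" if "x \<in> set b" for x
    using that b(2) assms acl_orbit[OF assms(1)] by blast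
  then have "finite (\<Union>x\<in>set b. ?O x)" by blast
  then have "finite {xs. set xs \<subseteq> (\<Union>x\<in>set b. ?O x) \<and> length xs = length b}"
    by (rule finite_lists_length_eq)
  moreover have "set (map h b) \<subseteq> (\<Union>x\<in>set b. ?O x)" if "aut_over M A h" for h
    using that by fastforce
  then have "?L \<subseteq> {xs. set xs \<subseteq> (\<Union>x\<in>set b. ?O x) \<and> length xs = length b}"
    using length_map by blast
  ultimately have fin: "finite ?L" using finite_subset by blast
  have fin2: "finite {y. [y] \<in> psols M ([sort_of M m], \<phi>, b')}" if b': "b' \<in> ?L" for b'
  proof -
    obtain h where h: "b' = map h b" "automorphism M h" using b' by (auto simp: aut_over_def)
    have "psols M ([sort_of M m], \<phi>, b') = map h ` psols M \<psi>"
      using psols_act_image[OF h(2) is_struct \<psi>(1)] unfolding b(1) h(1) act.simps .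
    then have "finite (psols M ([sort_of M m], \<phi>, b'))" using \<psi>(3) by simp
    then have "finite ((\<lambda>y. [y]) ` {y. [y] \<in> psols M ([sort_of M m], \<phi>, b')})"
      by (rule finite_subset[rotated]) blast
    then show ?thesis by (rule finite_imageD) (simp add: inj_on_def)
  qed
  have "{h m | h. aut_over M A h} \<subseteq> (\<Union>b'\<in>?L. {y. [y] \<in> psols M ([sort_of M m], \<phi>, b')})"
  proof -
    have "[h m] \<in> psols M ([sort_of M m], \<phi>, map h b)" if "aut_over M A h" for h
      using psols_act[OF _ is_struct \<psi>(1), of h "[m]"] that \<psi>(2)
      unfolding b(1) act.simps aut_over_def by simp
    then show ?thesis by blast
  qed
  moreover have "finite (\<Union>b'\<in>?L. {y. [y] \<in> psols M ([sort_of M m], \<phi>, b')})"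
    by (rule finite_UN_I[OF fin fin2])
  ultimately have "finite {h m | h. aut_over M A h}" by (rule finite_subset)
  then show "m \<in> acl M A" using acl_orbit[OF assms(1)] by blast
qed

end

section \<open>Thorn-forking in terms of algebraic closure\<close>

lemma finite_card_le_if_no_distinct_list:
  assumes "\<not> (\<exists>ys. distinct ys \<and> length ys = Suc N \<and> (\<forall>y\<in>set ys. P y))"
  shows "finite {y. P y} \<and> card {y. P y} \<le> N"
proof (rule ccontr)
  assume no: "\<not> (finite {y. P y} \<and> card {y. P y} \<le> N)"
  have "\<exists>B\<subseteq>{y. P y}. finite B \<and> card B = Suc N"
  proof (cases "finite {y. P y}")
    case True
    then have "Suc N \<le> card {y. P y}" using no by simp
    from obtain_subset_with_card_n[OF this] show ?thesis by metis
  next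
    case False
    then show ?thesis using infinite_arbitrarily_large by metis
  qed
  then obtain B where B: "B \<subseteq> {y. P y}" "finite B" "card B = Suc N" by blast
  obtain ys where "set ys = B" "distinct ys" using finite_distinct_list[OF B(2)] by blast
  then show False using assms B distinct_card[of ys] by (metis mem_Collect_eq subsetD)
qed

text \<open>
  A formula \<open>\<phi>(x, y, d)\<close> that for every \<open>x\<close> has at most \<open>N\<close> solutions \<open>y\<close> of the sort of \<open>m\<close>. The
  uniform bound is what makes the formulas \<open>\<phi>(x, m', d)\<close>, for distinct \<open>m'\<close>, \<open>(N+1)\<close>-inconsistent.
\<close>

definition bounded_fibres ::
  "('s, 'f, 'r, 'm) fo_struct \<Rightarrow> 's list \<Rightarrow> 'm \<Rightarrow> 'm list \<Rightarrow> ('s, 'f, 'r) fm \<Rightarrow> nat \<Rightarrow> bool" where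
  "bounded_fibres M \<sigma> m d \<phi> N \<longleftrightarrow> is_form M (\<sigma> @ sorts M (m # d)) \<phi> \<and>
     (\<forall>x. sorts M x = \<sigma> \<longrightarrow>
        finite {y. sort_of M y = sort_of M m \<and> sat M (x @ y # d) \<phi>} \<and>
        card {y. sort_of M y = sort_of M m \<and> sat M (x @ y # d) \<phi>} \<le> N)"

text \<open>
  An algebraic formula for \<open>m\<close> over \<open>Db\<close> has finitely many solutions, say \<open>N\<close>. Adding the condition
  that there are at most \<open>N\<close> solutions does not change it at \<open>b\<close>, and bounds its fibres elsewhere.
\<close>

lemma acl_bounded_fibres:
  assumes "m \<in> acl M (D \<union> set b)"
  obtains d \<phi> N where "set d \<subseteq> D" "bounded_fibres M (sorts M b) m d \<phi> N" "sat M (b @ m # d) \<phi>"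
proof -
  let ?s = "sort_of M m"
  obtain p R where p: "set p \<subseteq> D \<union> set b" "definable M (?s # sorts M p) R" "R (m # p)"
    "finite {y. sort_of M y = ?s \<and> R (y # p)}"
    using assms by (rule acl_E)
  define d where "d = filter (\<lambda>x. x \<in> D) p"
  have d: "set d \<subseteq> D" by (auto simp: d_def)
  have "\<exists>j. j < length (b @ d) \<and> (b @ d) ! j = p ! i" if "i < length p" for i
  proof -
    have "p ! i \<in> set (b @ d)" using p(1) nth_mem[OF that] by (auto simp: d_def)
    then show ?thesis by (metis in_set_conv_nth)
  qed
  then obtain r where r: "\<And>i. i < length p \<Longrightarrow> r i < length (b @ d) \<and> (b @ d) ! r i = p ! i"
    by metis
  \<comment> \<open>The algebraic formula \<open>R(y, p)\<close>, with its parameters sorted into \<open>b\<close> and \<open>d\<close>.\<close>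
  define R1 where "R1 e = R (pull (lift_ren r) (Suc (length p)) e)" for e
  have R1: "R1 (y # e) = R (y # pull r (length p) e)" for y e
    unfolding R1_def by (simp only: pull_lift)
  have "pull r (length p) (b @ d) = p" by (rule nth_equalityI) (use r in auto)
  then have R1p: "R1 (y # b @ d) = R (y # p)" for y unfolding R1 by simp
  have defR1: "definable M (?s # sorts M (b @ d)) R1"
  proof -
    have "definable M (sorts M (m # b @ d)) (\<lambda>e. R (pull (lift_ren r) (length (?s # sorts M p)) e))"
    proof (rule definable_rearrange[OF p(2), of "m # p"])
      fix i assume "i < length (m # p)"
      then show "(m # p) ! i = (m # b @ d) ! lift_ren r i" "lift_ren r i < length (m # b @ d)"
        using r by (auto simp: lift_ren_def nth_Cons split: nat.splits)
    qed simp
    then show ?thesis unfolding R1_def by simp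
  qed
  define N where "N = card {y. sort_of M y = ?s \<and> R1 (y # b @ d)}"
  \<comment> \<open>There are more than \<open>N\<close> solutions, where \<open>N\<close> is the number of solutions at \<open>b\<close>.\<close>
  define Q where "Q e \<longleftrightarrow> (\<exists>ys. distinct ys \<and> length ys = Suc N \<and>
    (\<forall>y\<in>set ys. sort_of M y = ?s \<and> R1 (y # e)))" for e
  have "definable M (sorts M (b @ d)) Q"
    unfolding Q_def by (rule definable_many[OF defR1])
  then have "definable M (?s # sorts M (b @ d)) (\<lambda>e. Q (drop 1 e))"
    using definable_skip[of M "[]" "sorts M (b @ d)" Q "[?s]"] by simp
  then have defR2: "definable M (?s # sorts M (b @ d)) (\<lambda>e. R1 e \<and> \<not> Q (drop 1 e))"
    by (intro definable_conj definable_not defR1)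
  \<comment> \<open>From the order \<open>y, x, d\<close> of the variables to the order \<open>x, y, d\<close>.\<close>
  define q where "q i = (if i = 0 then length b else if i \<le> length b then i - 1 else i)" for i
  let ?n = "length (?s # sorts M (b @ d))"
  have perm: "(y # x @ d) ! i = (x @ y # d) ! q i" "q i < length (x @ y # d)"
    if "length x = length b" "i < length (y # x @ d)" for x y i
    using that by (auto simp: q_def nth_append nth_Cons' diff_diff_left)
  have "definable M (sorts M (b @ m # d)) (\<lambda>e. R1 (pull q ?n e) \<and> \<not> Q (drop 1 (pull q ?n e)))"
    by (rule definable_rearrange[OF defR2, of "m # b @ d"]) (use perm in auto)
  then obtain \<phi> where \<phi>: "is_form M (sorts M (b @ m # d)) \<phi>"
    "\<And>e. sorts M e = sorts M (b @ m # d) \<Longrightarrow>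
       sat M e \<phi> \<longleftrightarrow> R1 (pull q ?n e) \<and> \<not> Q (drop 1 (pull q ?n e))"
    unfolding definable_def by blast
  have sat: "sat M (x @ y # d) \<phi> \<longleftrightarrow> R1 (y # x @ d) \<and> \<not> Q (x @ d)"
    if x: "sorts M x = sorts M b" and y: "sort_of M y = ?s" for x y
  proof -
    have len: "length x = length b" using arg_cong[OF x, of length] by simp
    have "pull q ?n (x @ y # d) = y # x @ d"
    proof (rule nth_equalityI)
      fix i assume "i < length (pull q ?n (x @ y # d))"
      then have "i < length (y # x @ d)" using len by simp
      then show "pull q ?n (x @ y # d) ! i = (y # x @ d) ! i"
        using perm(1)[OF len] len by (simp del: upt_Suc)
    qed (use len in \<open>simp del: upt_Suc\<close>)
    moreover have "sorts M (x @ y # d) = sorts M (b @ m # d)" using x y by simp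
    ultimately show ?thesis using \<phi>(2)[of "x @ y # d"] by (simp del: upt_Suc)
  qed
  have "bounded_fibres M (sorts M b) m d \<phi> N"
    unfolding bounded_fibres_def
  proof (intro conjI[OF _ allI] impI)
    show "is_form M (sorts M b @ sorts M (m # d)) \<phi>" using \<phi>(1) by simp
    fix x assume x: "sorts M x = sorts M b"
    have "\<not> (\<exists>ys. distinct ys \<and> length ys = Suc N \<and>
        (\<forall>y\<in>set ys. sort_of M y = ?s \<and> sat M (x @ y # d) \<phi>))"
    proof
      assume "\<exists>ys. distinct ys \<and> length ys = Suc N \<and>
        (\<forall>y\<in>set ys. sort_of M y = ?s \<and> sat M (x @ y # d) \<phi>)"
      then obtain ys where ys: "distinct ys" "length ys = Suc N"
        "\<forall>y\<in>set ys. sort_of M y = ?s \<and> sat M (x @ y # d) \<phi>" by blast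
      then have "Q (x @ d)" unfolding Q_def using sat[OF x] by blast
      moreover obtain y where "y \<in> set ys" using ys(2) by (cases ys) auto
      ultimately show False using ys(3) sat[OF x] by blast
    qed
    then show "finite {y. sort_of M y = ?s \<and> sat M (x @ y # d) \<phi>} \<and>
        card {y. sort_of M y = ?s \<and> sat M (x @ y # d) \<phi>} \<le> N"
      by (rule finite_card_le_if_no_distinct_list)
  qed
  moreover have "sat M (b @ m # d) \<phi>"
  proof -
    have fin: "finite {y. sort_of M y = ?s \<and> R1 (y # b @ d)}" unfolding R1p by (rule p(4))
    have "\<not> Q (b @ d)"
    proof
      assume "Q (b @ d)"
      then obtain ys where ys: "distinct ys" "length ys = Suc N"
        "set ys \<subseteq> {y. sort_of M y = ?s \<and> R1 (y # b @ d)}" unfolding Q_def by blast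
      then have "Suc N \<le> N" using card_mono[OF fin ys(3)] distinct_card[of ys] by (simp add: N_def)
      then show False by simp
    qed
    then show ?thesis unfolding sat[OF refl refl] R1p using p(3) by blast
  qed
  ultimately show thesis using that d by blast
qed

lemma bounded_fibres_acl:
  assumes b: "sorts M b = \<sigma>" and bd: "bounded_fibres M \<sigma> m d \<phi> N" and sat: "sat M (b @ m # d) \<phi>"
  shows "m \<in> acl M (set d \<union> set b)"
proof -
  let ?s = "sort_of M m"
  define q where "q i = (if i < length b then Suc i else if i = length b then 0 else i)" for i
  let ?n = "length (sorts M (b @ m # d))"
  have perm: "(b @ y # d) ! i = (y # b @ d) ! q i" "q i < length (y # b @ d)"
    if "i < length (b @ y # d)" for y i
    using that by (auto simp: q_def nth_append nth_Cons' diff_diff_left)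
  have form: "definable M (sorts M (b @ m # d)) (\<lambda>e. sat M e \<phi>)"
    by (rule definable_sat) (use bd b in \<open>simp add: bounded_fibres_def\<close>)
  have "definable M (sorts M (m # b @ d)) (\<lambda>e. sat M (pull q ?n e) \<phi>)"
    by (rule definable_rearrange[OF form, of "b @ m # d"]) (use perm in auto)
  moreover define R where "R = (\<lambda>e. sat M (pull q ?n e) \<phi>)"
  ultimately have def_R: "definable M (?s # sorts M (b @ d)) R" by (simp del: upt_Suc)
  have pull: "pull q ?n (y # b @ d) = b @ y # d" for y
    by (rule nth_equalityI) (use perm(1)[of _ y] in \<open>auto simp del: upt_Suc\<close>)
  have R: "R (y # b @ d) \<longleftrightarrow> sat M (b @ y # d) \<phi>" for y
    unfolding R_def pull ..
  show ?thesis
    by (rule acl_I[OF def_R]) (use bd b sat in \<open>auto simp: bounded_fibres_def R\<close>)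
qed

context monster
begin

text \<open>
  The algebraic source of thorn-forking. The formula \<open>\<phi>(x, m, d)\<close> with bounded fibres strongly
  divides over \<open>D\<close>: distinct conjugates of \<open>md\<close> over \<open>D\<close> are of the form \<open>m'd\<close> with distinct \<open>m'\<close>,
  and one \<open>x\<close> belongs to at most \<open>N\<close> of the resulting formulas.
\<close>

lemma type_thorn_forksI:
  assumes D: "small \<kappa> D" "C \<subseteq> D" "D \<subseteq> B" and m: "m \<in> B" "m \<in> acl M (D \<union> set b)" "m \<notin> acl M D"
  shows "type_thorn_forks M \<kappa> (tp M b B) C"
proof -
  obtain d \<phi> N where d: "set d \<subseteq> D" and bd: "bounded_fibres M (sorts M b) m d \<phi> N"
    and sat: "sat M (b @ m # d) \<phi>"
    using m(2) by (rule acl_bounded_fibres)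
  let ?\<psi> = "(sorts M b, \<phi>, m # d)"
  have form: "?\<psi> \<in> pforms M (sorts M b) B"
    using bd d D(3) m(1) by (auto simp: pforms_iff bounded_fibres_def)
  have "strongly_divides M ?\<psi> D"
    unfolding strongly_divides.simps
  proof (intro conjI exI[of _ "Suc N"] allI impI notI)
    assume "set (m # d) \<subseteq> acl M D"
    then show False using m(3) by simp
  next
    fix S
    assume S: "S \<subseteq> {b'. tp M b' D = tp M (m # d) D} \<and> finite S \<and> card S = Suc N"
      and "\<exists>a. sorts M a = sorts M b \<and> (\<forall>b'\<in>S. a \<in> psols M (sorts M b, \<phi>, b'))"
    then obtain a where a: "sorts M a = sorts M b" "\<And>b'. b' \<in> S \<Longrightarrow> sat M (a @ b') \<phi>" by auto
    let ?F = "{y. sort_of M y = sort_of M m \<and> sat M (a @ y # d) \<phi>}"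
    have "b' \<in> (\<lambda>y. y # d) ` ?F" if b': "b' \<in> S" for b'
    proof -
      have "tp M (m # d) D = tp M b' D" using S b' by auto
      then obtain y where "b' = y # d" "sort_of M y = sort_of M m"
        using d by (rule tp_eq_Cons_params)
      then show ?thesis using a(2)[OF b'] by blast
    qed
    then have "S \<subseteq> (\<lambda>y. y # d) ` ?F" by blast
    moreover have fin: "finite ?F" "card ?F \<le> N" using bd a(1) by (auto simp: bounded_fibres_def)
    ultimately have "card S \<le> card ((\<lambda>y. y # d) ` ?F)" by (intro card_mono) auto
    also have "\<dots> \<le> card ?F" by (rule card_image_le[OF fin(1)])
    finally show False using S fin(2) by simp
  qed
  then have "thorn_divides M \<kappa> ?\<psi> C" unfolding thorn_divides_def using D by blast
  moreover have "?\<psi> \<in> pforms M (sorts M b) UNIV" using form pforms_mono[of B UNIV] by blast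
  ultimately have "thorn_forks M \<kappa> ?\<psi> C"
    unfolding thorn_forks_def by (intro exI[of _ "{?\<psi>}"]) simp
  moreover have "?\<psi> \<in> tp M b B" using form sat by (simp add: tp_iff)
  ultimately show ?thesis unfolding type_thorn_forks_def by blast
qed

text \<open>
  If an entry of \<open>c\<close> were not algebraic over \<open>Db\<close>, then \<open>c\<close> would have infinitely many conjugates over
  \<open>Db\<close>, and \<open>b\<close> would satisfy \<open>\<phi>(x, c')\<close> for all of them.
\<close>

lemma strongly_divides_acl:
  assumes D: "small \<kappa> D" and form: "(\<sigma>, \<phi>, c) \<in> pforms M \<sigma> UNIV"
    and div: "strongly_divides M (\<sigma>, \<phi>, c) D" and b: "b \<in> psols M (\<sigma>, \<phi>, c)"
  shows "set c \<subseteq> acl M (D \<union> set b)"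
proof (rule ccontr)
  assume "\<not> set c \<subseteq> acl M (D \<union> set b)"
  then obtain i where i: "i < length c" "c ! i \<notin> acl M (D \<union> set b)"
    by (auto simp: in_set_conv_nth subset_iff)
  let ?A = "D \<union> set b"
  let ?S = "{map h c | h. aut_over M ?A h}"
  have "{h (c ! i) | h. aut_over M ?A h} \<subseteq> (\<lambda>l. l ! i) ` ?S" using i(1) by force
  moreover have "infinite {h (c ! i) | h. aut_over M ?A h}"
    using acl_orbit[of ?A "c ! i"] i(2) D by simp
  ultimately have "infinite ?S" using finite_subset finite_imageI by blast
  obtain k where k: "\<And>S. S \<subseteq> {b'. tp M b' D = tp M c D} \<and> finite S \<and> card S = k \<Longrightarrow>
      \<not> (\<exists>a. sorts M a = \<sigma> \<and> (\<forall>b'\<in>S. a \<in> psols M (\<sigma>, \<phi>, b')))"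
    using div by auto
  obtain S where S: "S \<subseteq> ?S" "finite S" "card S = k"
    using infinite_arbitrarily_large[OF \<open>infinite ?S\<close>] by blast
  have *: "tp M (map h c) D = tp M c D \<and> b \<in> psols M (\<sigma>, \<phi>, map h c)" if h: "aut_over M ?A h" for h
  proof -
    have "map h b = b" using h by (auto simp: aut_over_def intro!: map_idI)
    moreover have "map h b \<in> psols M (act h (\<sigma>, \<phi>, c))"
      using psols_act[OF _ is_struct form] h b unfolding aut_over_def by blast
    moreover have "aut_over M D h" using h by (rule aut_over_mono) blast
    ultimately show ?thesis using tp_aut_over[OF _ is_struct] by simp
  qed
  have "S \<subseteq> {b'. tp M b' D = tp M c D}" and "\<forall>b'\<in>S. b \<in> psols M (\<sigma>, \<phi>, b')"
    using S(1) * by blast+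
  moreover have "sorts M b = \<sigma>" using b by simp
  ultimately show False using k S by blast
qed

text \<open>
  A uniform version of the previous lemma: one finite tuple \<open>d\<close> from \<open>D\<close> serves all solutions \<open>b\<close>.
  The solution set of \<open>\<phi>(x, c)\<close> is covered by the formulas \<open>\<chi>(x, m, d)\<close> with bounded fibres, and
  finitely many of these suffice.
\<close>

lemma strongly_divides_witness:
  assumes D: "small \<kappa> D" and form: "(\<sigma>, \<phi>, c) \<in> pforms M \<sigma> UNIV"
    and div: "strongly_divides M (\<sigma>, \<phi>, c) D"
  obtains m d where "set d \<subseteq> D" "m \<notin> acl M D"
    "\<And>b. b \<in> psols M (\<sigma>, \<phi>, c) \<Longrightarrow> m \<in> acl M (set d \<union> set b)"
proof -
  obtain m where m: "m \<in> set c" "m \<notin> acl M D" using div by auto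
  define C where "C = {(\<sigma>, \<chi>, m # d) | \<chi> d. set d \<subseteq> D \<and> (\<exists>N. bounded_fibres M \<sigma> m d \<chi> N)}"
  let ?A = "D \<union> set c"
  have C: "C \<subseteq> pforms M \<sigma> ?A"
    using m(1) by (auto simp: C_def pforms_iff bounded_fibres_def)
  have p: "{(\<sigma>, \<phi>, c)} \<subseteq> pforms M \<sigma> ?A" using form by (auto simp: pforms_iff)
  have cover: "\<exists>\<chi>\<in>C. b \<in> psols M \<chi>"
    if "sorts M b = \<sigma>" "\<And>\<psi>. \<psi> \<in> {(\<sigma>, \<phi>, c)} \<Longrightarrow> b \<in> psols M \<psi>" for b
  proof -
    have b: "sorts M b = \<sigma>" "b \<in> psols M (\<sigma>, \<phi>, c)" using that by blast+
    have "m \<in> acl M (D \<union> set b)" using strongly_divides_acl[OF D form div b(2)] m(1) by blast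
    then obtain d \<chi> N where "set d \<subseteq> D" "bounded_fibres M (sorts M b) m d \<chi> N" "sat M (b @ m # d) \<chi>"
      by (rule acl_bounded_fibres)
    then show ?thesis using b(1) by (intro bexI[of _ "(\<sigma>, \<chi>, m # d)"]) (auto simp: C_def)
  qed
  have "\<exists>p0 C0. finite p0 \<and> p0 \<subseteq> {(\<sigma>, \<phi>, c)} \<and> finite C0 \<and> C0 \<subseteq> C \<and>
    (\<forall>b. sorts M b = \<sigma> \<and> (\<forall>\<psi>\<in>p0. b \<in> psols M \<psi>) \<longrightarrow> (\<exists>\<chi>\<in>C0. b \<in> psols M \<chi>))"
    by (rule compactness[OF _ p C]) (use D cover in auto)
  then obtain p0 C0 where C0: "p0 \<subseteq> {(\<sigma>, \<phi>, c)}" "finite C0" "C0 \<subseteq> C"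
    "\<forall>b. sorts M b = \<sigma> \<and> (\<forall>\<psi>\<in>p0. b \<in> psols M \<psi>) \<longrightarrow> (\<exists>\<chi>\<in>C0. b \<in> psols M \<chi>)"
    by blast
  let ?D0 = "\<Union>\<chi>\<in>C0. set (tl (snd (snd \<chi>)))"
  have "finite ?D0" using C0(2) by auto
  from finite_list[OF this] obtain d where d: "set d = ?D0" by blast
  have "set d \<subseteq> D" using C0(3) unfolding d C_def by fastforce
  moreover have "m \<in> acl M (set d \<union> set b)" if b: "b \<in> psols M (\<sigma>, \<phi>, c)" for b
  proof -
    have sb: "sorts M b = \<sigma>" using b by simp
    have "\<forall>\<psi>\<in>p0. b \<in> psols M \<psi>" using C0(1) b by blast
    then obtain \<chi> where \<chi>: "\<chi> \<in> C0" "b \<in> psols M \<chi>" using C0(4) sb by blast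
    then obtain \<theta> d' N where *: "\<chi> = (\<sigma>, \<theta>, m # d')" "bounded_fibres M \<sigma> m d' \<theta> N"
      using C0(3) unfolding C_def by blast
    then have "m \<in> acl M (set d' \<union> set b)" using bounded_fibres_acl[OF sb *(2)] \<chi>(2) by simp
    moreover have "set d' \<subseteq> set d" unfolding d using \<chi>(1) *(1) by force
    ultimately show ?thesis using acl_mono[of "set d' \<union> set b" "set d \<union> set b" M] by blast
  qed
  ultimately show thesis using that m(2) by blast
qed

text \<open>
  The finite tuple \<open>f\<close> collects the witnesses for all disjuncts of the thorn-forking formula. It works
  for all realisations of the type at once, since each of them satisfies one of the disjuncts. This
  uniformity permits to move \<open>f\<close> over \<open>B\<close> afterwards.
\<close>

lemma type_thorn_forks_witness:
  assumes "type_thorn_forks M \<kappa> (tp M b B) C"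
  obtains f where "\<And>b'. tp M b' B = tp M b B \<Longrightarrow>
    \<exists>m\<in>set f. \<exists>d. set d \<subseteq> set f \<and> m \<notin> acl M (C \<union> set d) \<and> m \<in> acl M (C \<union> set d \<union> set b')"
proof -
  obtain \<psi> F where \<psi>: "\<psi> \<in> tp M b B" and F: "finite F" "F \<subseteq> pforms M (fst \<psi>) UNIV"
    "\<And>\<theta>. \<theta> \<in> F \<Longrightarrow> thorn_divides M \<kappa> \<theta> C" "psols M \<psi> \<subseteq> (\<Union>\<theta>\<in>F. psols M \<theta>)"
    using assms unfolding type_thorn_forks_def thorn_forks_def by blast
  have "\<exists>g. hd g \<in> set g \<and> hd g \<notin> acl M (C \<union> set (tl g)) \<and>
      (\<forall>b'\<in>psols M \<theta>. hd g \<in> acl M (set (tl g) \<union> set b'))" if \<theta>: "\<theta> \<in> F" for \<theta>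
  proof -
    obtain D where D: "C \<subseteq> D" "small \<kappa> D" "strongly_divides M \<theta> D"
      using F(3)[OF \<theta>] unfolding thorn_divides_def by blast
    obtain \<phi> c where c: "\<theta> = (fst \<psi>, \<phi>, c)"
      using subsetD[OF F(2) \<theta>] by (rule pforms_E)
    obtain m d where md: "set d \<subseteq> D" "m \<notin> acl M D"
      "\<And>b. b \<in> psols M \<theta> \<Longrightarrow> m \<in> acl M (set d \<union> set b)"
      using strongly_divides_witness[OF D(2)] subsetD[OF F(2) \<theta>] D(3) unfolding c by metis
    have "m \<notin> acl M (C \<union> set d)" using md(1,2) D(1) acl_mono[of "C \<union> set d" D M] by blast
    then show ?thesis using md(3) by (intro exI[of _ "m # d"]) simp
  qed
  then obtain g where g: "\<And>\<theta>. \<theta> \<in> F \<Longrightarrow> hd (g \<theta>) \<in> set (g \<theta>) \<and> hd (g \<theta>) \<notin> acl M (C \<union> set (tl (g \<theta>))) \<and>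
      (\<forall>b'\<in>psols M \<theta>. hd (g \<theta>) \<in> acl M (set (tl (g \<theta>)) \<union> set b'))"
    by metis
  have "finite (\<Union>\<theta>\<in>F. set (g \<theta>))" using F(1) by simp
  from finite_list[OF this] obtain f where f: "set f = (\<Union>\<theta>\<in>F. set (g \<theta>))" by blast
  show thesis
  proof (rule that[of f])
    fix b' assume eq: "tp M b' B = tp M b B"
    have "b' \<in> psols M \<psi>" using \<psi> eq tp_iff by metis
    then obtain \<theta> where \<theta>: "\<theta> \<in> F" "b' \<in> psols M \<theta>" using F(4) by blast
    have "set (tl (g \<theta>)) \<subseteq> set (g \<theta>)" by (cases "g \<theta>") auto
    then have sub: "set (tl (g \<theta>)) \<subseteq> set f" "set (g \<theta>) \<subseteq> set f" using f \<theta>(1) by blast+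
    have "hd (g \<theta>) \<in> acl M (C \<union> set (tl (g \<theta>)) \<union> set b')"
      using g[OF \<theta>(1)] \<theta>(2) acl_mono[of "set (tl (g \<theta>)) \<union> set b'" "C \<union> set (tl (g \<theta>)) \<union> set b'" M]
      by blast
    then show "\<exists>m\<in>set f. \<exists>d. set d \<subseteq> set f \<and> m \<notin> acl M (C \<union> set d) \<and> m \<in> acl M (C \<union> set d \<union> set b')"
      using g[OF \<theta>(1)] sub by blast
  qed
qed

lemma type_thorn_forks_antimono:
  assumes "type_thorn_forks M \<kappa> p C" "A \<subseteq> C"
  shows "type_thorn_forks M \<kappa> p A"
proof -
  have "thorn_divides M \<kappa> \<theta> C \<Longrightarrow> thorn_divides M \<kappa> \<theta> A" for \<theta>
    unfolding thorn_divides_def using assms(2) by blast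
  then show ?thesis
    using assms(1) unfolding type_thorn_forks_def thorn_forks_def by meson
qed

lemma thorn_forks_cover:
  assumes "finite \<Theta>" "\<And>\<theta>. \<theta> \<in> \<Theta> \<Longrightarrow> thorn_forks M \<kappa> \<theta> C \<and> fst \<theta> = fst \<psi>"
    and "psols M \<psi> \<subseteq> (\<Union>\<theta>\<in>\<Theta>. psols M \<theta>)"
  shows "thorn_forks M \<kappa> \<psi> C"
proof -
  have "\<forall>\<theta>\<in>\<Theta>. \<exists>F. finite F \<and> F \<subseteq> pforms M (fst \<psi>) UNIV \<and>
      (\<forall>\<theta>\<in>F. thorn_divides M \<kappa> \<theta> C) \<and> psols M \<theta> \<subseteq> (\<Union>\<theta>\<in>F. psols M \<theta>)"
    using assms(2) unfolding thorn_forks_def by metis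
  then obtain F where F: "\<And>\<theta>. \<theta> \<in> \<Theta> \<Longrightarrow> finite (F \<theta>) \<and> F \<theta> \<subseteq> pforms M (fst \<psi>) UNIV \<and>
      (\<forall>\<theta>\<in>F \<theta>. thorn_divides M \<kappa> \<theta> C) \<and> psols M \<theta> \<subseteq> (\<Union>\<theta>\<in>F \<theta>. psols M \<theta>)"
    by metis
  show ?thesis
    unfolding thorn_forks_def
  proof (intro exI[of _ "\<Union>\<theta>\<in>\<Theta>. F \<theta>"] conjI)
    show "finite (\<Union>\<theta>\<in>\<Theta>. F \<theta>)" using assms(1) F by blast
    show "(\<Union>\<theta>\<in>\<Theta>. F \<theta>) \<subseteq> pforms M (fst \<psi>) UNIV" using F by blast
    show "\<forall>\<theta>\<in>\<Union>\<theta>\<in>\<Theta>. F \<theta>. thorn_divides M \<kappa> \<theta> C" using F by blast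
    have "psols M \<theta> \<subseteq> (\<Union>\<chi>\<in>(\<Union>\<theta>\<in>\<Theta>. F \<theta>). psols M \<chi>)" if "\<theta> \<in> \<Theta>" for \<theta>
      using F[OF that] that by blast
    then show "psols M \<psi> \<subseteq> (\<Union>\<chi>\<in>(\<Union>\<theta>\<in>\<Theta>. F \<theta>). psols M \<chi>)"
      by (intro subset_trans[OF assms(3)] UN_least)
  qed
qed

text \<open>
  Suppose that every realisation of \<open>tp(f/CX)\<close> satisfies some formula over \<open>CY\<close> that thorn-forks over
  \<open>C\<close>. By compactness a formula of \<open>tp(f/CX)\<close> implies a finite disjunction of these, and so
  thorn-forks itself.
\<close>

lemma thorn_indep_extension:
  assumes ind: "thorn_indep M \<kappa> f C X" and sub: "X \<subseteq> Y" and small: "small \<kappa> (C \<union> Y)"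
  obtains h where "aut_over M (C \<union> X) h" "thorn_indep M \<kappa> (map h f) C Y"
proof -
  define F where "F = {\<chi> \<in> pforms M (sorts M f) (C \<union> Y). thorn_forks M \<kappa> \<chi> C}"
  have smallX: "small \<kappa> (C \<union> X)" using small sub small_subset[of "C \<union> Y" "C \<union> X"] by blast
  have F: "F \<subseteq> pforms M (sorts M f) (C \<union> Y)" by (auto simp: F_def)
  have "\<exists>f'. tp M f' (C \<union> X) = tp M f (C \<union> X) \<and> \<not> (\<exists>\<chi>\<in>F. f' \<in> psols M \<chi>)"
  proof (rule ccontr)
    assume "\<not> ?thesis"
    then have cover: "\<exists>\<chi>\<in>F. f' \<in> psols M \<chi>" if "tp M f' (C \<union> X) = tp M f (C \<union> X)" for f'
      using that by blast
    obtain \<theta> F0 where \<theta>: "\<theta> \<in> tp M f (C \<union> X)" "finite F0" "F0 \<subseteq> F"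
      "psols M \<theta> \<subseteq> (\<Union>\<chi>\<in>F0. psols M \<chi>)"
      by (rule tp_cover[OF smallX small F cover])
    have "thorn_forks M \<kappa> \<theta> C"
    proof (rule thorn_forks_cover[OF \<theta>(2) _ \<theta>(4)])
      fix \<chi> assume "\<chi> \<in> F0"
      then have "\<chi> \<in> pforms M (sorts M f) (C \<union> Y)" "thorn_forks M \<kappa> \<chi> C"
        using \<theta>(3) by (auto simp: F_def)
      moreover have "\<theta> \<in> pforms M (sorts M f) (C \<union> X)" using \<theta>(1) by (simp add: tp_iff)
      ultimately show "thorn_forks M \<kappa> \<chi> C \<and> fst \<chi> = fst \<theta>" by (auto simp: pforms_def)
    qed
    then show False
      using ind \<theta>(1) unfolding thorn_indep_def type_thorn_forks_def by blast
  qed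
  then obtain f' where f': "tp M f' (C \<union> X) = tp M f (C \<union> X)" "\<And>\<chi>. \<chi> \<in> F \<Longrightarrow> f' \<notin> psols M \<chi>"
    by blast
  obtain h where h: "aut_over M (C \<union> X) h" "map h f = f'"
    by (rule homogeneity[OF smallX sym[OF f'(1)]])
  have "\<not> thorn_forks M \<kappa> \<chi> C" if "\<chi> \<in> tp M f' (C \<union> Y)" for \<chi>
    using that f'(2)[of \<chi>] tp_sorts[OF f'(1)] unfolding tp_iff F_def by auto
  then have "thorn_indep M \<kappa> f' C Y"
    unfolding thorn_indep_def type_thorn_forks_def by blast
  then show thesis using that h by blast
qed

text \<open>
  Adjoining an independent tuple \<open>f\<close> does not make elements algebraic. This is how independence
  keeps the witnesses for the rank of another tuple intact.
\<close>

lemma thorn_indep_acl: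
  assumes ind: "thorn_indep M \<kappa> f C Y" and small: "small \<kappa> C"
    and d: "set d \<subseteq> C \<union> Y" and m: "m \<in> C \<union> Y" "m \<notin> acl M (C \<union> set d)"
  shows "m \<notin> acl M (C \<union> set d \<union> set f)"
proof
  assume "m \<in> acl M (C \<union> set d \<union> set f)"
  then have "type_thorn_forks M \<kappa> (tp M f (C \<union> Y)) C"
    using small d m by (intro type_thorn_forksI[of "C \<union> set d" C "C \<union> Y" m f]) auto
  then show False using ind by (simp add: thorn_indep_def)
qed

lemma thorn_indep_base:
  assumes "thorn_indep M \<kappa> f C (X \<union> Y)"
  shows "thorn_indep M \<kappa> f (C \<union> X) Y"
  using assms type_thorn_forks_antimono[of "tp M f (C \<union> X \<union> Y)" "C \<union> X" C]
  unfolding thorn_indep_def by (auto simp: Un_assoc)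

end

section \<open>Invariance under automorphisms\<close>

context monster
begin

lemma strongly_divides_act:
  assumes h: "automorphism M h" and form: "(\<sigma>, \<phi>, b) \<in> pforms M \<sigma> UNIV"
    and div: "strongly_divides M (\<sigma>, \<phi>, b) D"
  shows "strongly_divides M (\<sigma>, \<phi>, map h b) (h ` D)"
proof -
  have hinv: "automorphism M (inv h)" using h by (rule automorphism_inv)
  have ih: "map (inv h) (map h c) = c" for c
    using inv_o_automorphism[OF h] by simp
  have hi: "map h (map (inv h) c) = c" for c
    using o_inv_automorphism[OF h] by simp
  have ihD: "inv h ` h ` D = D" using automorphism_inj[OF h] by (simp add: image_image)
  obtain k where k: "\<And>S. S \<subseteq> {b'. tp M b' D = tp M b D} \<and> finite S \<and> card S = k \<Longrightarrow>
      \<not> (\<exists>a. sorts M a = \<sigma> \<and> (\<forall>b'\<in>S. a \<in> psols M (\<sigma>, \<phi>, b')))"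
    and nacl: "\<not> set b \<subseteq> acl M D"
    using div by auto
  show ?thesis
    unfolding strongly_divides.simps
  proof (intro conjI exI[of _ k] allI impI)
    show "\<not> set (map h b) \<subseteq> acl M (h ` D)"
      using nacl acl_aut_iff[OF h] by auto
    fix S
    assume S: "S \<subseteq> {b'. tp M b' (h ` D) = tp M (map h b) (h ` D)} \<and> finite S \<and> card S = k"
    show "\<not> (\<exists>a. sorts M a = \<sigma> \<and> (\<forall>b'\<in>S. a \<in> psols M (\<sigma>, \<phi>, b')))"
    proof
      assume "\<exists>a. sorts M a = \<sigma> \<and> (\<forall>b'\<in>S. a \<in> psols M (\<sigma>, \<phi>, b'))"
      then obtain a where a: "sorts M a = \<sigma>" "\<And>b'. b' \<in> S \<Longrightarrow> a \<in> psols M (\<sigma>, \<phi>, b')" by blast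
      have tpS: "tp M (map (inv h) b') D = tp M b D" if b': "b' \<in> S" for b'
      proof -
        have eq: "tp M b' (h ` D) = tp M (map h b) (h ` D)" using S b' by blast
        have "tp M (map (inv h) b') D = act (inv h) ` tp M b' (h ` D)"
          using tp_act[OF hinv is_struct, of b' "h ` D"] unfolding ihD .
        also have "\<dots> = tp M (map (inv h) (map h b)) D"
          using tp_act[OF hinv is_struct, of "map h b" "h ` D"] unfolding ihD eq by (rule sym)
        finally show ?thesis unfolding ih .
      qed
      have "map (inv h) a \<in> psols M (\<sigma>, \<phi>, map (inv h) b')" if b': "b' \<in> S" for b'
      proof -
        have "sorts M (map (inv h) b') = sorts M b" using tp_sorts[OF tpS[OF b']] .
        then have "(\<sigma>, \<phi>, map (inv h) b') \<in> pforms M \<sigma> UNIV"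
          using form unfolding pforms_iff by simp
        from psols_act[OF h is_struct this, of "map (inv h) a"]
        show ?thesis using a(2)[OF b'] unfolding act.simps hi by blast
      qed
      then have "\<forall>b'\<in>map (inv h) ` S. map (inv h) a \<in> psols M (\<sigma>, \<phi>, b')" by blast
      moreover have "sorts M (map (inv h) a) = \<sigma>"
        unfolding automorphism_sorts[OF hinv] by (rule a(1))
      moreover have "inj (map (inv h))" using automorphism_inj[OF hinv] by simp
      then have "card (map (inv h) ` S) = k" using S card_image inj_on_subset subset_UNIV by metis
      moreover have "map (inv h) ` S \<subseteq> {b'. tp M b' D = tp M b D}" using tpS by blast
      ultimately show False using k[of "map (inv h) ` S"] S by blast
    qed
  qed
qed

lemma thorn_divides_act:
  assumes h: "automorphism M h" and form: "\<theta> \<in> pforms M \<sigma> UNIV" and div: "thorn_divides M \<kappa> \<theta> C"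
  shows "thorn_divides M \<kappa> (act h \<theta>) (h ` C)"
proof -
  obtain D where D: "C \<subseteq> D" "small \<kappa> D" "strongly_divides M \<theta> D"
    using div unfolding thorn_divides_def by blast
  obtain \<phi> c where c: "\<theta> = (\<sigma>, \<phi>, c)" using form by (rule pforms_E)
  have "strongly_divides M (act h \<theta>) (h ` D)"
    using strongly_divides_act[OF h] form D(3) unfolding c act.simps by blast
  moreover have "small \<kappa> (h ` D)"
    using D(2) by (rule small_image)
  ultimately show ?thesis unfolding thorn_divides_def using D(1) by blast
qed

lemma thorn_forks_act:
  assumes h: "automorphism M h" and form: "\<psi> \<in> pforms M \<sigma> UNIV" and fork: "thorn_forks M \<kappa> \<psi> C"
  shows "thorn_forks M \<kappa> (act h \<psi>) (h ` C)"
proof -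
  have \<sigma>: "fst \<psi> = \<sigma>" using form by (auto simp: pforms_def)
  obtain F where F: "finite F" "F \<subseteq> pforms M \<sigma> UNIV"
    "\<And>\<theta>. \<theta> \<in> F \<Longrightarrow> thorn_divides M \<kappa> \<theta> C" "psols M \<psi> \<subseteq> (\<Union>\<theta>\<in>F. psols M \<theta>)"
    using fork unfolding thorn_forks_def \<sigma> by blast
  show ?thesis
    unfolding thorn_forks_def fst_act \<sigma>
  proof (intro exI[of _ "act h ` F"] conjI ballI)
    show "finite (act h ` F)" using F(1) by simp
    show "act h ` F \<subseteq> pforms M \<sigma> UNIV"
    proof (rule image_subsetI)
      fix \<theta> assume "\<theta> \<in> F"
      then have "act h \<theta> \<in> pforms M \<sigma> (h ` UNIV)" using pforms_act[OF h] F(2) by blast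
      then show "act h \<theta> \<in> pforms M \<sigma> UNIV" using pforms_mono[of "h ` UNIV" UNIV M \<sigma>] by blast
    qed
    fix \<theta> assume "\<theta> \<in> act h ` F"
    then show "thorn_divides M \<kappa> \<theta> (h ` C)" using thorn_divides_act[OF h] F(2,3) by blast
  next
    have "map h ` psols M \<psi> \<subseteq> (\<Union>\<theta>\<in>F. map h ` psols M \<theta>)" using F(4) by blast
    also have "\<dots> = (\<Union>\<theta>\<in>F. psols M (act h \<theta>))"
      by (intro SUP_cong refl) (use psols_act_image[OF h is_struct] F(2) in blast)
    finally show "psols M (act h \<psi>) \<subseteq> (\<Union>\<theta>\<in>act h ` F. psols M \<theta>)"
      using psols_act_image[OF h is_struct form] by auto
  qed
qed

lemma type_thorn_forks_act:
  assumes h: "automorphism M h" and fork: "type_thorn_forks M \<kappa> (tp M b B) C"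
  shows "type_thorn_forks M \<kappa> (tp M (map h b) (h ` B)) (h ` C)"
proof -
  obtain \<psi> where \<psi>: "\<psi> \<in> tp M b B" "thorn_forks M \<kappa> \<psi> C"
    using fork unfolding type_thorn_forks_def by blast
  have "\<psi> \<in> pforms M (sorts M b) UNIV"
    using \<psi>(1) pforms_mono[of B UNIV M "sorts M b"] unfolding tp_iff by blast
  then have "thorn_forks M \<kappa> (act h \<psi>) (h ` C)" using thorn_forks_act[OF h] \<psi>(2) by blast
  then show ?thesis
    unfolding tp_act[OF h is_struct] type_thorn_forks_def using \<psi>(1) by blast
qed

lemma thorn_forking_extension_act:
  assumes h: "automorphism M h" and ext: "thorn_forking_extension M \<kappa> p q"
  shows "thorn_forking_extension M \<kappa> (act h ` p) (act h ` q)"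
proof -
  obtain b A B where *: "A \<subseteq> B" "small \<kappa> B" "p = tp M b A" "q = tp M b B" "type_thorn_forks M \<kappa> q A"
    using ext unfolding thorn_forking_extension_def by blast
  have "small \<kappa> (h ` B)"
    using *(2) by (rule small_image)
  moreover have "type_thorn_forks M \<kappa> (tp M (map h b) (h ` B)) (h ` A)"
    using type_thorn_forks_act[OF h] *(5) unfolding *(4) by blast
  ultimately show ?thesis
    unfolding thorn_forking_extension_def *(3,4) tp_act[OF h is_struct, symmetric]
    using image_mono[OF *(1)] by blast
qed

lemma Uth_ge_act:
  assumes h: "automorphism M h" and "Uth_ge M \<kappa> p \<alpha>"
  shows "Uth_ge M \<kappa> (act h ` p) \<alpha>"
  using assms(2)
proof (induction rule: Uth_ge.induct)
  case (succ \<alpha> \<alpha>' p q)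
  then show ?case using thorn_forking_extension_act[OF h] Uth_ge.succ by blast
qed (auto intro: Uth_ge.zero Uth_ge.limit)

lemma Uth_ge_tp_act:
  assumes "automorphism M h" "Uth_ge M \<kappa> (tp M b B) \<alpha>"
  shows "Uth_ge M \<kappa> (tp M (map h b) (h ` B)) \<alpha>"
  using Uth_ge_act[OF assms] unfolding tp_act[OF assms(1) is_struct] .

section \<open>Thorn-forking extensions and the rank\<close>

lemma Uth_ge_antimono:
  assumes "Uth_ge M \<kappa> (tp M b B) \<alpha>" "A \<subseteq> B"
  shows "Uth_ge M \<kappa> (tp M b A) \<alpha>"
proof -
  have "Uth_ge M \<kappa> (tp M b A) \<alpha>" if "Uth_ge M \<kappa> p \<alpha>" "p = tp M b B" for p
    using that
  proof (induction rule: Uth_ge.induct)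
    case (succ \<alpha> \<alpha>' p q)
    obtain c B0 B1 where c: "B0 \<subseteq> B1" "small \<kappa> B1" "p = tp M c B0" "q = tp M c B1"
      "type_thorn_forks M \<kappa> q B0"
      using succ(2) unfolding thorn_forking_extension_def by blast
    have eq: "tp M b B = tp M c B0" using succ.prems c(3) by simp
    then have B0: "B0 = B" using tp_params by blast
    have "tp M b A = tp M c A" using tp_mono[OF eq[unfolded B0] assms(2)] .
    moreover have "A \<subseteq> B1" using B0 c(1) assms(2) by blast
    moreover have "type_thorn_forks M \<kappa> q A"
      using type_thorn_forks_antimono[OF c(5)] B0 assms(2) by blast
    ultimately have "thorn_forking_extension M \<kappa> (tp M b A) q"
      unfolding thorn_forking_extension_def using c(2,4) by blast
    then show ?case using succ(1,3) by (blast intro: Uth_ge.succ)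
  qed (auto intro: Uth_ge.zero Uth_ge.limit)
  then show ?thesis using assms(1) by blast
qed

lemma thorn_forking_extension_tp:
  "C \<subseteq> B \<Longrightarrow> small \<kappa> B \<Longrightarrow> type_thorn_forks M \<kappa> (tp M b B) C \<Longrightarrow>
    thorn_forking_extension M \<kappa> (tp M b C) (tp M b B)"
  unfolding thorn_forking_extension_def
  by (rule exI[of _ b], rule exI[of _ C], rule exI[of _ B]) simp

lemma Uth_ge_succI:
  "ord_succ \<alpha> \<alpha>' \<Longrightarrow> C \<subseteq> B \<Longrightarrow> small \<kappa> B \<Longrightarrow> type_thorn_forks M \<kappa> (tp M b B) C \<Longrightarrow>
    Uth_ge M \<kappa> (tp M b B) \<alpha> \<Longrightarrow> Uth_ge M \<kappa> (tp M b C) \<alpha>'"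
  by (rule Uth_ge.succ[OF _ thorn_forking_extension_tp])

text \<open>
  By homogeneity, a thorn-forking extension of \<open>tp(b/C)\<close> can be moved so that it is realised by \<open>b\<close>
  itself; then only the set of parameters grows.
\<close>

lemma thorn_forking_extension_realised:
  assumes "thorn_forking_extension M \<kappa> (tp M b C) q" "Uth_ge M \<kappa> q \<alpha>"
  obtains B where "C \<subseteq> B" "small \<kappa> B" "type_thorn_forks M \<kappa> (tp M b B) C" "Uth_ge M \<kappa> (tp M b B) \<alpha>"
proof -
  obtain c C' B where c: "C' \<subseteq> B" "small \<kappa> B" "tp M b C = tp M c C'" "q = tp M c B"
    "type_thorn_forks M \<kappa> q C'"
    using assms(1) unfolding thorn_forking_extension_def by blast
  have C': "C' = C" using tp_params[OF c(3)] by simp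
  have "small \<kappa> C" using c(1,2) C' small_subset by blast
  then obtain h where h: "aut_over M C h" "map h c = b"
    using c(3) C' by (metis homogeneity)
  have aut: "automorphism M h" using h(1) by (simp add: aut_over_def)
  show thesis
  proof (rule that[of "h ` B"])
    show "C \<subseteq> h ` B" using c(1) C' aut_over_image[OF h(1)] by blast
    show "small \<kappa> (h ` B)"
      using c(2) by (rule small_image)
    show "type_thorn_forks M \<kappa> (tp M b (h ` B)) C"
      using type_thorn_forks_act[OF aut, of c B C] c(4,5) C' h(2) aut_over_image[OF h(1)] by simp
    show "Uth_ge M \<kappa> (tp M b (h ` B)) \<alpha>"
      using Uth_ge_tp_act[OF aut, of c B \<alpha>] assms(2) c(4) h(2) by simp
  qed
qed

end

lemma Uth_ge_succD:
  assumes "Uth_ge M \<kappa> p \<alpha>'" "ord_succ \<alpha> \<alpha>'"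
  shows "\<exists>q. thorn_forking_extension M \<kappa> p q \<and> Uth_ge M \<kappa> q \<alpha>"
  using assms(1)
proof (cases rule: Uth_ge.cases)
  case zero
  then show ?thesis using assms(2) by (auto simp: ord_zero_def ord_succ_def)
next
  case (succ \<beta> q)
  have "\<beta> = \<alpha>"
    using succ(1) assms(2) unfolding ord_succ_def by (metis leD neqE)
  then show ?thesis using succ by blast
next
  case limit
  then show ?thesis using assms(2) by (auto simp: ord_limit_def)
qed

section \<open>Rosiness and the rank of independent extensions\<close>

locale rosy_monster = monster T M \<kappa>
  for T :: "('s, 'f, 'r) fm set" and M :: "('s, 'f, 'r, 'm) fo_struct" and \<kappa> :: "'k rel" +
  assumes rosy: "rosy T M \<kappa>"
begin

text \<open>
  Local character yields \<open>B \<subseteq> C\<close> over which \<open>tp(f/C)\<close> does not thorn-fork, and enlarging the base from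
  \<open>B\<close> to \<open>C\<close> cannot create thorn-forking.
\<close>

lemma thorn_indep_existence:
  assumes "small \<kappa> C"
  shows "thorn_indep M \<kappa> f C {}"
proof -
  obtain B where B: "B \<subseteq> C" "thorn_indep M \<kappa> f B C"
    using rosy assms unfolding rosy_def by blast
  then have "\<not> type_thorn_forks M \<kappa> (tp M f C) B"
    unfolding thorn_indep_def by (simp add: Un_absorb1)
  then show ?thesis
    unfolding thorn_indep_def using type_thorn_forks_antimono[OF _ B(1)] by auto
qed

lemma thorn_indep_full_existence:
  assumes "small \<kappa> (C \<union> Y)"
  obtains h where "aut_over M C h" "thorn_indep M \<kappa> (map h f) C Y"
proof -
  have "small \<kappa> C" using assms small_subset by blast
  from thorn_indep_extension[OF thorn_indep_existence[OF this] empty_subsetI assms]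
  show thesis using that by auto
qed

text \<open>
  The successor step of the rank in terms of algebraic closure, under the assumption that independent
  tuples preserve rank \<open>\<beta>\<close>. In the induction below this assumption is the induction hypothesis, and
  afterwards it is the result of the induction. The witnesses \<open>f\<close> of thorn-forking are made independent
  from \<open>b\<close> over \<open>B\<close>, so that they can be adjoined to \<open>B\<close>.
\<close>

lemma thorn_forking_extension_witness:
  assumes preserve: "\<And>B f. small \<kappa> B \<Longrightarrow> thorn_indep M \<kappa> f B (set b) \<Longrightarrow>
      Uth_ge M \<kappa> (tp M b B) \<beta> \<Longrightarrow> Uth_ge M \<kappa> (tp M b (B \<union> set f)) \<beta>"
    and ext: "thorn_forking_extension M \<kappa> (tp M b C) q" and q: "Uth_ge M \<kappa> q \<beta>"
  obtains m d where "m \<notin> acl M (C \<union> set d)" "m \<in> acl M (C \<union> set d \<union> set b)"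
    "Uth_ge M \<kappa> (tp M b (insert m (C \<union> set d))) \<beta>"
proof -
  obtain B where B: "C \<subseteq> B" "small \<kappa> B" "type_thorn_forks M \<kappa> (tp M b B) C"
    "Uth_ge M \<kappa> (tp M b B) \<beta>"
    using ext q by (rule thorn_forking_extension_realised)
  obtain f where f: "\<And>b'. tp M b' B = tp M b B \<Longrightarrow>
    \<exists>m\<in>set f. \<exists>d. set d \<subseteq> set f \<and> m \<notin> acl M (C \<union> set d) \<and> m \<in> acl M (C \<union> set d \<union> set b')"
    using type_thorn_forks_witness[OF B(3)] by blast
  have "small \<kappa> (B \<union> set b)" using B(2) by simp
  then obtain h where h: "aut_over M B h" and ind: "thorn_indep M \<kappa> (map h f) B (set b)"
    by (rule thorn_indep_full_existence)
  have aut: "automorphism M h" using h by (simp add: aut_over_def)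
  have U: "Uth_ge M \<kappa> (tp M b (B \<union> set (map h f))) \<beta>" using preserve[OF B(2) ind B(4)] .
  \<comment> \<open>Moving \<open>f\<close> by \<open>h\<close> while \<open>b\<close> stays fixed amounts to moving \<open>b\<close> by the inverse of \<open>h\<close>.\<close>
  define b' where "b' = map (inv h) b"
  have "tp M b' B = tp M b B"
    unfolding b'_def using tp_aut_over[OF aut_over_inv[OF h] is_struct] .
  then obtain m d where md: "m \<in> set f" "set d \<subseteq> set f" "m \<notin> acl M (C \<union> set d)"
    "m \<in> acl M (C \<union> set d \<union> set b')"
    using f by blast
  have hC: "h ` C = C" using aut_over_image[OF aut_over_mono[OF h B(1)]] .
  have "map h b' = b" unfolding b'_def using o_inv_automorphism[OF aut] by simp
  then have hb: "h ` set b' = set b" by (metis set_map)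
  show thesis
  proof (rule that[of "h m" "map h d"])
    show "h m \<notin> acl M (C \<union> set (map h d))"
      using acl_aut_iff[OF aut, of m "C \<union> set d"] md(3) by (simp add: image_Un hC)
    show "h m \<in> acl M (C \<union> set (map h d) \<union> set b)"
      using acl_aut_iff[OF aut, of m "C \<union> set d \<union> set b'"] md(4) by (simp add: image_Un hC hb)
    show "Uth_ge M \<kappa> (tp M b (insert (h m) (C \<union> set (map h d)))) \<beta>"
      by (rule Uth_ge_antimono[OF U]) (use md(1,2) B(1) in auto)
  qed
qed

text \<open>
  The independent tuple stands on the left of the independence relation, so that it can be extended
  to be independent from the witnesses \<open>m\<close> and \<open>d\<close> for the rank of \<open>b\<close>. By \<open>thorn_indep_acl\<close> these
  remain witnesses over \<open>Cf\<close>.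
\<close>

lemma Uth_ge_thorn_indep:
  fixes \<alpha> :: "'o::wellorder"
  assumes "small \<kappa> C" "thorn_indep M \<kappa> f C (set b)" "Uth_ge M \<kappa> (tp M b C) \<alpha>"
  shows "Uth_ge M \<kappa> (tp M b (C \<union> set f)) \<alpha>"
  using assms
proof (induction \<alpha> arbitrary: b C f rule: less_induct)
  case (less \<alpha>)
  from less.prems(3) show ?case
  proof (cases rule: Uth_ge.cases)
    case zero
    then show ?thesis by (rule Uth_ge.zero)
  next
    case limit
    show ?thesis
      by (rule Uth_ge.limit[OF limit(1)]) (rule less.IH[OF _ less.prems(1,2) limit(2)])
  next
    case (succ \<beta> q)
    have \<beta>: "\<beta> < \<alpha>" using succ(1) by (simp add: ord_succ_def)
    obtain m d where md: "m \<notin> acl M (C \<union> set d)" "m \<in> acl M (C \<union> set d \<union> set b)"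
      "Uth_ge M \<kappa> (tp M b (insert m (C \<union> set d))) \<beta>"
      using thorn_forking_extension_witness[OF less.IH[OF \<beta>] succ(2,3)] by blast
    let ?X = "insert m (set d)"
    have "small \<kappa> (C \<union> (?X \<union> set b))"
      using less.prems(1) small_finite[of "?X \<union> set b"] small_Un by blast
    then obtain h where h: "aut_over M (C \<union> set b) h"
      and ind: "thorn_indep M \<kappa> (map h f) C (?X \<union> set b)"
      using thorn_indep_extension[OF less.prems(2), of "?X \<union> set b"] by blast
    let ?f = "set (map h f)"
    have "m \<notin> acl M (C \<union> set d \<union> ?f)"
      by (rule thorn_indep_acl[OF ind less.prems(1)]) (use md(1) in auto)
    moreover have "m \<in> acl M (C \<union> set d \<union> ?f \<union> set b)"
      by (rule subsetD[OF acl_mono md(2)]) auto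
    ultimately have fork: "type_thorn_forks M \<kappa> (tp M b (insert m (C \<union> set d) \<union> ?f)) (C \<union> ?f)"
      by (intro type_thorn_forksI[of "C \<union> set d \<union> ?f"]) (use less.prems(1) in auto)
    have "thorn_indep M \<kappa> (map h f) (insert m (C \<union> set d)) (set b)"
      using thorn_indep_base[OF ind] by simp
    then have "Uth_ge M \<kappa> (tp M b (insert m (C \<union> set d) \<union> ?f)) \<beta>"
      using less.prems(1) md(3) by (intro less.IH[OF \<beta>]) simp_all
    then have U: "Uth_ge M \<kappa> (tp M b (C \<union> ?f)) \<alpha>"
      by (intro Uth_ge_succI[OF succ(1) _ _ fork]) (use less.prems(1) in auto)
    \<comment> \<open>The rank has been computed over the moved copy of \<open>f\<close>; move it back over \<open>Cb\<close>.\<close>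
    have inv: "aut_over M (C \<union> set b) (inv h)" using h by (rule aut_over_inv)
    then have "map (inv h) b = b" "inv h ` C = C"
      by (auto simp: aut_over_def intro!: map_idI)
    moreover have "inv h ` ?f = set f"
      using h automorphism_inj[of M h] by (auto simp: aut_over_def image_image)
    ultimately show ?thesis
      using Uth_ge_tp_act[OF _ U, of "inv h"] inv by (simp add: aut_over_def image_Un)
  qed
qed

lemma Uth_ge_succE:
  assumes "thorn_forking_extension M \<kappa> (tp M b C) q" "Uth_ge M \<kappa> q \<beta>"
  obtains m d where "m \<notin> acl M (C \<union> set d)" "m \<in> acl M (C \<union> set d \<union> set b)"
    "Uth_ge M \<kappa> (tp M b (insert m (C \<union> set d))) \<beta>"
  by (rule thorn_forking_extension_witness[OF Uth_ge_thorn_indep assms])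

text \<open>
  If \<open>a\<close> is algebraic over \<open>C\<close>, then \<open>acl(Cda) = acl(Cd)\<close> leaves no room for a witness of rank one.
\<close>

lemma Uth_ge_1_not_algebraic:
  assumes "small \<kappa> C" "Uth_ge M \<kappa> (tp M a C) (1::nat)"
  shows "\<not> set a \<subseteq> acl M C"
proof
  assume a: "set a \<subseteq> acl M C"
  have "ord_succ 0 (1::nat)" by (auto simp: ord_succ_def)
  then obtain q where "thorn_forking_extension M \<kappa> (tp M a C) q" "Uth_ge M \<kappa> q (0::nat)"
    using Uth_ge_succD[OF assms(2)] by blast
  then obtain m d where md: "m \<notin> acl M (C \<union> set d)" "m \<in> acl M (C \<union> set d \<union> set a)"
    by (rule Uth_ge_succE)
  have "C \<union> set d \<union> set a \<subseteq> acl M (C \<union> set d)"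
    using a subset_acl[of "C \<union> set d" M] acl_mono[of C "C \<union> set d" M] by blast
  then have "acl M (C \<union> set d \<union> set a) \<subseteq> acl M (C \<union> set d)"
    by (intro acl_subset_acl) (use assms(1) in simp)
  then show False using md by blast
qed

text \<open>
  If \<open>md\<close> had rank two over \<open>Ad\<close>, then the two steps, taken by \<open>n\<close> and then by \<open>m\<close>, would also be steps
  in the rank of \<open>b\<close>, since \<open>m\<close> is algebraic over \<open>Adb\<close>. With the rank \<open>\<alpha>\<close> that is left after
  adjoining \<open>m\<close> this adds up to \<open>\<alpha> + 2\<close>.
\<close>

lemma coordinate_type_minimal:
  fixes \<alpha> \<alpha>' :: "'o::wellorder"
  assumes succ: "ord_succ \<alpha> \<alpha>'" and A: "small \<kappa> A" and U: "Uth_eq M \<kappa> (tp M b A) \<alpha>'"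
    and m: "m \<notin> acl M (A \<union> set d)" "m \<in> acl M (A \<union> set d \<union> set b)"
    and Um: "Uth_ge M \<kappa> (tp M b (insert m (A \<union> set d))) \<alpha>"
  shows "Uth_eq M \<kappa> (tp M (m # d) (A \<union> set d)) (1::nat)"
proof -
  define C where "C = A \<union> set d"
  have C: "small \<kappa> C" using A by (simp add: C_def)
  have "Uth_ge M \<kappa> (tp M (m # d) C) (1::nat)"
  proof (rule Uth_ge_succI[of 0])
    show "ord_succ 0 (1::nat)" by (auto simp: ord_succ_def)
    have "m \<in> acl M (C \<union> set (m # d))" using subset_acl[of "C \<union> set (m # d)" M] by auto
    then show "type_thorn_forks M \<kappa> (tp M (m # d) (insert m C)) C"
      by (intro type_thorn_forksI[of C]) (use C m(1) in \<open>auto simp: C_def\<close>)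
  qed (use C in \<open>auto intro: Uth_ge.zero simp: ord_zero_def\<close>)
  moreover have False
    if q: "thorn_forking_extension M \<kappa> (tp M (m # d) C) q" "Uth_ge M \<kappa> q (1::nat)" for q
  proof -
    obtain n f where n: "n \<notin> acl M (C \<union> set f)" "n \<in> acl M (C \<union> set f \<union> set (m # d))"
      and U1: "Uth_ge M \<kappa> (tp M (m # d) (insert n (C \<union> set f))) (1::nat)"
      using q by (rule Uth_ge_succE)
    have "\<not> set (m # d) \<subseteq> acl M (insert n (C \<union> set f))"
      by (rule Uth_ge_1_not_algebraic[OF _ U1]) (use C in simp)
    moreover have "set d \<subseteq> acl M (insert n (C \<union> set f))"
      using subset_acl[of "insert n (C \<union> set f)" M] by (auto simp: C_def)
    ultimately have mn: "m \<notin> acl M (C \<union> set (n # f))" by simp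
    have "small \<kappa> (insert m C \<union> set b)" using C by simp
    then obtain h where h: "aut_over M (insert m C) h"
      and ind: "thorn_indep M \<kappa> (map h (n # f)) (insert m C) (set b)"
      by (rule thorn_indep_full_existence)
    have aut: "automorphism M h" "h m = m" using h by (auto simp: aut_over_def)
    have hC: "h ` C = C" using h by (auto simp: aut_over_def)
    define B where "B = C \<union> set (map h (n # f))"
    have B: "small \<kappa> B" using C by (simp add: B_def)
    have "insert m C \<union> set (map h (n # f)) = insert m B" by (auto simp: B_def)
    moreover have "Uth_ge M \<kappa> (tp M b (insert m C)) \<alpha>" using Um by (simp add: C_def)
    ultimately have UB: "Uth_ge M \<kappa> (tp M b (insert m B)) \<alpha>"
      using Uth_ge_thorn_indep[OF _ ind] C by simp
    \<comment> \<open>The step taken by \<open>m\<close> over \<open>B\<close> gives rank \<open>\<alpha> + 1\<close>.\<close>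
    have mB: "m \<notin> acl M B"
      using acl_aut_iff[OF aut(1), of m "C \<union> set (n # f)"] mn aut(2) hC
      by (simp add: B_def image_Un)
    have "m \<in> acl M (B \<union> set b)"
      by (rule subsetD[OF acl_mono m(2)]) (auto simp: B_def C_def)
    then have "type_thorn_forks M \<kappa> (tp M b (insert m B)) B"
      by (intro type_thorn_forksI[of B]) (use B mB in auto)
    then have "Uth_ge M \<kappa> (tp M b B) \<alpha>'"
      by (intro Uth_ge_succI[OF succ _ _ _ UB]) (use B in auto)
    \<comment> \<open>The step taken by \<open>n\<close> from \<open>A\<close> to \<open>B\<close> gives rank \<open>\<alpha> + 2\<close>.\<close>
    moreover have "type_thorn_forks M \<kappa> (tp M b B) A"
    proof (rule type_thorn_forksI[of "C \<union> set (map h f)"])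
      show "small \<kappa> (C \<union> set (map h f))" using C by simp
      show "h n \<notin> acl M (C \<union> set (map h f))"
        using acl_aut_iff[OF aut(1), of n "C \<union> set f"] n(1) hC by (simp add: image_Un)
      have "C \<union> set f \<union> set (m # d) = insert m (C \<union> set f)" by (auto simp: C_def)
      then have "h n \<in> acl M (insert m (C \<union> set (map h f)))"
        using acl_aut_iff[OF aut(1), of n "insert m (C \<union> set f)"] n(2) hC aut(2) by (simp add: image_Un)
      moreover have "insert m (C \<union> set (map h f)) \<subseteq> acl M (C \<union> set (map h f) \<union> set b)"
      proof -
        have "m \<in> acl M (C \<union> set (map h f) \<union> set b)"
          by (rule subsetD[OF acl_mono m(2)]) (auto simp: C_def)
        then show ?thesis using subset_acl[of "C \<union> set (map h f) \<union> set b" M] by blast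
      qed
      then have "acl M (insert m (C \<union> set (map h f))) \<subseteq> acl M (C \<union> set (map h f) \<union> set b)"
        by (intro acl_subset_acl) (use C in \<open>simp add: Un_assoc small_Un small_finite\<close>)
      ultimately show "h n \<in> acl M (C \<union> set (map h f) \<union> set b)" by blast
    qed (auto simp: B_def C_def)
    then have "thorn_forking_extension M \<kappa> (tp M b A) (tp M b B)"
      by (intro thorn_forking_extension_tp) (use B in \<open>auto simp: B_def C_def\<close>)
    ultimately show False using U unfolding Uth_eq_def by blast
  qed
  ultimately show ?thesis unfolding Uth_eq_def C_def by blast
qed

text \<open>
  The tuple \<open>a = md\<close> includes the parameters \<open>d\<close>, so that \<open>m\<close> stays algebraic over \<open>Adb'\<close> for all \<open>b'\<close>
  with the type of \<open>b\<close> over \<open>Aa\<close>.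
\<close>

lemma strongly_dividing_minimal_coordinate:
  fixes \<alpha> \<alpha>' :: "'o::wellorder"
  assumes succ: "ord_succ \<alpha> \<alpha>'" and A: "small \<kappa> A" and U: "Uth_eq M \<kappa> (tp M b A) \<alpha>'"
  obtains a e where "Uth_eq M \<kappa> (tp M b (A \<union> set a)) \<alpha>" "thorn_indep M \<kappa> b A (set e)"
    "thorn_indep M \<kappa> b (A \<union> set a) (set e)"
    "type_strongly_divides M b (A \<union> set a) (A \<union> set e)"
    "Uth_eq M \<kappa> (tp M a (A \<union> set e)) (1::nat)"
proof -
  have no: "\<not> Uth_ge M \<kappa> (tp M b B) \<alpha>'"
    if "A \<subseteq> B" "small \<kappa> B" "type_thorn_forks M \<kappa> (tp M b B) A" for B
    using U unfolding Uth_eq_def not_ex de_Morgan_conj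
    by (metis thorn_forking_extension_tp[OF that])
  obtain q where "thorn_forking_extension M \<kappa> (tp M b A) q" "Uth_ge M \<kappa> q \<alpha>"
    using U Uth_ge_succD[OF _ succ] unfolding Uth_eq_def by blast
  then obtain m d where m: "m \<notin> acl M (A \<union> set d)" "m \<in> acl M (A \<union> set d \<union> set b)"
    and Um: "Uth_ge M \<kappa> (tp M b (insert m (A \<union> set d))) \<alpha>"
    by (rule Uth_ge_succE)
  have Aa: "A \<union> set (m # d) = insert m (A \<union> set d)" by auto
  have small: "small \<kappa> (insert m (A \<union> set d))" "small \<kappa> (A \<union> set d)" using A by simp_all
  have fork: "type_thorn_forks M \<kappa> (tp M b (insert m (A \<union> set d))) (A \<union> set d)"
    by (rule type_thorn_forksI[of "A \<union> set d"]) (use small m in auto)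
  have Ud: "Uth_ge M \<kappa> (tp M b (A \<union> set d)) \<alpha>'"
    by (rule Uth_ge_succI[OF succ _ small(1) fork Um]) auto
  show thesis
  proof (rule that[of "m # d" d])
    have "\<not> Uth_ge M \<kappa> (tp M b (insert m (A \<union> set d))) \<alpha>'"
      by (rule no[OF _ small(1) type_thorn_forks_antimono[OF fork]]) auto
    then show "Uth_eq M \<kappa> (tp M b (A \<union> set (m # d))) \<alpha>"
      unfolding Aa Uth_eq_def using Um Uth_ge.succ[OF succ] by blast
    show "thorn_indep M \<kappa> b A (set d)"
      unfolding thorn_indep_def using no[OF _ small(2)] Ud by blast
    have "A \<union> set (m # d) \<union> set d = A \<union> set (m # d)" by auto
    then show "thorn_indep M \<kappa> b (A \<union> set (m # d)) (set d)"
      using thorn_indep_existence[OF small(1), of b] unfolding thorn_indep_def Aa by simp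
    show "type_strongly_divides M b (A \<union> set (m # d)) (A \<union> set d)"
      unfolding type_strongly_divides_def Aa
    proof (intro conjI allI impI)
      show "\<not> insert m (A \<union> set d) \<subseteq> acl M (A \<union> set d)" using m(1) by blast
      fix b' assume "tp M b' (insert m (A \<union> set d)) = tp M b (insert m (A \<union> set d))"
      then obtain h where h: "aut_over M (insert m (A \<union> set d)) h" "map h b = b'"
        using small(1) by (metis homogeneity)
      have "h m \<in> acl M (h ` (A \<union> set d \<union> set b))"
        by (rule acl_aut[OF _ m(2)]) (use h(1) in \<open>simp add: aut_over_def\<close>)
      moreover have "h ` (A \<union> set d) = A \<union> set d" "h m = m"
        using h(1) by (auto simp: aut_over_def)
      moreover have "h ` set b = set b'" using h(2) by auto
      ultimately have "m \<in> acl M (A \<union> set d \<union> set b')" by (simp only: image_Un)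
      then show "insert m (A \<union> set d) \<subseteq> acl M (A \<union> set d \<union> set b')"
        using subset_acl[of "A \<union> set d \<union> set b'" M] by blast
    qed
    show "Uth_eq M \<kappa> (tp M (m # d) (A \<union> set d)) (1::nat)"
      by (rule coordinate_type_minimal[OF succ A U m Um])
  qed
qed

end

section \<open>The theorem\<close>

theorem proposition3p6:
  fixes T :: "('s, 'f, 'r) fm set"
    and M :: "('s, 'f, 'r, 'm) fo_struct"
    and \<kappa> :: "'k rel"
    and \<alpha> \<alpha>' :: "'o::wellorder"
  assumes "monster_model T M \<kappa>"
    and "eq_closed M"
    and "rosy T M \<kappa>"
    and "ord_succ \<alpha> \<alpha>'"
  shows "(\<forall>b A. small \<kappa> A \<and> Uth_eq M \<kappa> (tp M b A) \<alpha>' \<longrightarrow>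
           (\<exists>a e. Uth_eq M \<kappa> (tp M b (A \<union> set a)) \<alpha> \<and>
              thorn_indep M \<kappa> b A (set e) \<and>
              thorn_indep M \<kappa> b (A \<union> set a) (set e) \<and>
              type_strongly_divides M b (A \<union> set a) (A \<union> set e) \<and>
              Uth_eq M \<kappa> (tp M a (A \<union> set e)) (1::nat)))
       \<and> (\<forall>b A. small \<kappa> A \<and> Uth_eq M \<kappa> (tp M b A) \<alpha>' \<longrightarrow>
           (\<exists>a e. thorn_indep M \<kappa> b A (set e) \<and>
              set a \<subseteq> acl M (A \<union> set b \<union> set e) \<and>
              thorn_minimal M \<kappa> (tp M a (A \<union> set e))))"
    (is "(\<forall>b A. ?hyp b A \<longrightarrow> ?one b A) \<and> (\<forall>b A. ?hyp b A \<longrightarrow> ?two b A)")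
proof -
  interpret rosy_monster T M \<kappa>
    using assms by unfold_locales
  have one: "?one b A" if "?hyp b A" for b A
    using strongly_dividing_minimal_coordinate[OF assms(4)] that by metis
  moreover have "?two b A" if hyp: "?hyp b A" for b A
  proof -
    obtain a e where e: "thorn_indep M \<kappa> b A (set e)"
      and div: "type_strongly_divides M b (A \<union> set a) (A \<union> set e)"
      and U: "Uth_eq M \<kappa> (tp M a (A \<union> set e)) (1::nat)"
      using one[OF hyp] by blast
    have "A \<union> set a \<subseteq> acl M (A \<union> set e \<union> set b)"
      using div unfolding type_strongly_divides_def by blast
    then have "set a \<subseteq> acl M (A \<union> set b \<union> set e)" by (simp add: Un_ac)
    then show ?thesis using e U unfolding thorn_minimal_def by blast
  qed
  ultimately show ?thesis by blast
qed

end
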